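(* For every integer $d\ge 3$ one has ${\bf S}_d=[0,+\infty]$, i.e. for every $\gamma\in[0,+\infty]$ there exists a $d$-dimensional lattice $\Lambda\subset\mathbb{R}^d$ with $\omega(\Lambda)=\gamma$, and $\omega(\Lambda)\in[0,+\infty]$ for every $d$-dimensional lattice $\Lambda$.
   Context: For ${\bf x}=(x_1,\dots,x_d)^\top\in\mathbb{R}^d$ let $|{\bf x}|=\max_{1\le i\le d}|x_i|$ and $\Pi({\bf x})=\prod_{i=1}^d|x_i|^{1/d}$. For a $d$-dimensional lattice $\Lambda\subset\mathbb{R}^d$ put $\psi_\Lambda(t)=\min_{{\bf x}\in\Lambda:\,0<|{\bf x}|\le t}\Pi({\bf x})$ and define the Diophantine exponent $\omega(\Lambda)=\sup\{\gamma\in\mathbb{R}:\ \liminf_{t\to+\infty}t^\gamma\psi_\Lambda(t)<+\infty\}$, equivalently the supremum of $\gamma$ such that there are infinitely many ${\bf x}\in\Lambda$ with $\Pi({\bf x})\le|{\bf x}|^{-\gamma}$. Let ${\bf S}_d=\{\omega(\Lambda):\ \Lambda \text{ a } d\text{-dimensional lattice in }\mathbb{R}^d\}$. *)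

theory Defs
  imports "HOL-Analysis.Analysis"
begin

definition full_lattice :: "(real^'n) set \<Rightarrow> bool" where
  "full_lattice \<Lambda> \<longleftrightarrow>
     (\<exists>B. independent B \<and> span B = UNIV \<and>
          \<Lambda> = {\<Sum>b\<in>B. of_int (c b) *\<^sub>R b | c :: real^'n \<Rightarrow> int. True})"

text \<open>The library's \<^const>\<open>infnorm\<close> is the maximum norm.\<close>

lemma infnorm_eq_Max: "infnorm (x :: real^'n) = (MAX i. \<bar>x $ i\<bar>)"
  by (simp add: infnorm_cart cSup_eq_Max full_SetCompr_eq)

definition geo_prod :: "real^'n \<Rightarrow> real" where
  "geo_prod x = (\<Prod>i\<in>UNIV. \<bar>x $ i\<bar> powr (1 / real CARD('n)))"

text \<open>For a lattice the set below is finite (see \<open>finite_lattice_points\<close>), and it is nonempty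
  for all large \<open>t\<close>. For small \<open>t\<close> it may be empty, which makes the value unspecified but does
  not affect the limit inferior at infinity.\<close>

definition lattice_psi :: "(real^'n) set \<Rightarrow> real \<Rightarrow> real" where
  "lattice_psi \<Lambda> t = Min (geo_prod ` {x \<in> \<Lambda>. 0 < infnorm x \<and> infnorm x \<le> t})"

definition dioph_exponent :: "(real^'n) set \<Rightarrow> ereal" where
  "dioph_exponent \<Lambda> =
     Sup {ereal \<gamma> | \<gamma>. Liminf at_top (\<lambda>t::real. ereal (t powr \<gamma> * lattice_psi \<Lambda> t)) < \<infinity>}"

lemma finite_lattice_points:
  fixes \<Lambda> :: "(real^'n) set"
  assumes "full_lattice \<Lambda>"
  shows "finite {x \<in> \<Lambda>. 0 < infnorm x \<and> infnorm x \<le> t}"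
proof -
  from assms obtain B where B: "independent B" "span B = UNIV"
    and L: "\<Lambda> = {\<Sum>b\<in>B. of_int (c b) *\<^sub>R b | c :: real^'n \<Rightarrow> int. True}"
    unfolding full_lattice_def by blast
  have finB: "finite B" using B(1) by (rule independent_imp_finite)
  have lin: "linear (\<lambda>x. representation B x b)" for b
    using B by (intro linearI) (simp_all add: representation_add representation_scale)
  have "\<exists>K. \<forall>x. \<bar>representation B x b\<bar> \<le> K * norm x" for b
    using linear_bounded[OF lin[of b]] by simp
  then obtain K where K: "\<And>b x. \<bar>representation B x b\<bar> \<le> K b * norm x" by metis
  have fin: "finite (\<Lambda> \<inter> cball 0 r)" for r
  proof -
    define F where "F = (\<lambda>c :: real^'n \<Rightarrow> int. \<Sum>b\<in>B. of_int (c b) *\<^sub>R b)"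
    define N where "N b = \<lceil>\<bar>K b\<bar> * r\<rceil>" for b
    have "\<Lambda> \<inter> cball 0 r \<subseteq> F ` (PiE B (\<lambda>b. {- N b..N b}))"
    proof
      fix x assume "x \<in> \<Lambda> \<inter> cball 0 r"
      then obtain c where x: "x = F c" and r: "norm x \<le> r" by (auto simp: L F_def)
      have "c b \<in> {- N b..N b}" if "b \<in> B" for b
      proof -
        have "representation B x = (\<lambda>b. if b \<in> B then of_int (c b) else 0)"
          using B finB unfolding x F_def
          by (intro representation_eqI) (auto simp: intro!: sum.mono_neutral_cong_left split: if_splits)
        with that have "\<bar>of_int (c b)\<bar> \<le> K b * norm x" using K[of x b] by simp
        also have "\<dots> \<le> \<bar>K b\<bar> * r" using r by (intro mult_mono) auto
        also have "\<dots> \<le> of_int (N b)" unfolding N_def by simp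
        finally have "real_of_int \<bar>c b\<bar> \<le> of_int (N b)" by simp
        then have "\<bar>c b\<bar> \<le> N b" by (simp only: of_int_le_iff)
        then show ?thesis by auto
      qed
      moreover have "x = F (restrict c B)" unfolding x F_def by (intro sum.cong) auto
      ultimately show "x \<in> F ` (PiE B (\<lambda>b. {- N b..N b}))" by (intro image_eqI) auto
    qed
    moreover have "finite (F ` (PiE B (\<lambda>b. {- N b..N b})))"
      using finB by (intro finite_imageI finite_PiE) auto
    ultimately show ?thesis by (rule finite_subset)
  qed
  have "{x \<in> \<Lambda>. 0 < infnorm x \<and> infnorm x \<le> t} \<subseteq> \<Lambda> \<inter> cball 0 (sqrt DIM(real^'n) * t)"
  proof clarsimp
    fix x :: "real^'n" assume "infnorm x \<le> t"
    have "norm x \<le> sqrt DIM(real^'n) * infnorm x" by (rule norm_le_infnorm)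
    also have "\<dots> \<le> sqrt DIM(real^'n) * t" using \<open>infnorm x \<le> t\<close> by (intro mult_left_mono) auto
    finally show "norm x \<le> sqrt CARD('n) * t" by simp
  qed
  then show ?thesis using fin finite_subset by blast
qed

end

theory Submission
  imports Defs "HOL-Probability.Probability" "HOL-Real_Asymp.Real_Asymp"
begin

text \<open>
  The value \<open>\<infinity>\<close> is attained by the integer lattice. For finite \<open>\<gamma>\<close> put \<open>\<tau> = d - 1 + d \<gamma>\<close> and look for
  linear forms \<open>L\<^sub>1, \<dots>, L\<^sub>d\<close> such that the lattice of all \<open>(L\<^sub>1 z, \<dots>, L\<^sub>d z)\<close>, \<open>z\<close> integral, has
  exponent \<open>\<gamma>\<close>. The form \<open>L\<^sub>1 z = z\<^sub>1 - \<alpha> z\<^sub>2 + \<beta>\<^sub>3 z\<^sub>3 + \<dots> + \<beta>\<^sub>d z\<^sub>d\<close> has \<open>\<alpha>\<close> approximable by rationals to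
  order exactly \<open>\<tau>\<close>, which produces infinitely many \<open>z\<close> with \<open>\<bar>L\<^sub>1 z\<bar> \<le> C \<bar>z\<bar>\<^sup>-\<^sup>\<tau>\<close>, hence with product
  at most \<open>C' \<bar>z\<bar>\<close> to the power \<open>-d \<gamma>\<close>. All remaining coefficients are random. For the converse
  inequality, choose \<open>A > \<tau>\<close> and \<open>s < 1\<close> with \<open>A / s\<close> close to \<open>\<tau>\<close>, and show that the series of
  \<open>\<bar>z\<bar>\<^sup>-\<^sup>A \<bar>L\<^sub>1 z\<bar>\<^sup>-\<^sup>s\<close> converges. Since the mean of \<open>\<bar>L z\<bar>\<^sup>-\<^sup>s\<close> over a random form \<open>L\<close> is \<open>O(\<bar>z\<bar>\<^sup>-\<^sup>s)\<close>, each further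
  random form may be inserted with the factor \<open>(\<bar>z\<bar> / \<bar>L z\<bar>)\<^sup>s\<close> without destroying convergence. In the end every
  single term is bounded, so the product of all \<open>\<bar>L\<^sub>i z\<bar>\<close> is at least a constant times \<open>\<bar>z\<bar>\<close> to the power
  \<open>d - 1 - A / s\<close>, which is close to \<open>-d \<gamma>\<close>.
\<close>

section \<open>Mean values of negative powers of random linear forms\<close>

text \<open>An extended real, because the real-valued \<open>\<bar>x\<bar> powr - s\<close> has the junk value \<open>0\<close> at \<open>x = 0\<close>.\<close>

definition sing :: "real \<Rightarrow> real \<Rightarrow> ennreal" where
  "sing s x = inverse (ennreal (\<bar>x\<bar> powr s))"

lemma sing_measurable [measurable]: "sing s \<in> borel_measurable borel"
  unfolding sing_def by measurable

lemma sing_0 [simp]: "sing s 0 = \<infinity>"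
  by (simp add: sing_def)

lemma sing_nonzero: "x \<noteq> 0 \<Longrightarrow> sing s x = ennreal (\<bar>x\<bar> powr - s)"
  by (simp add: sing_def inverse_ennreal powr_minus)

lemma sing_mult: "sing s (x * y) = sing s x * sing s y"
  by (simp add: sing_def abs_mult powr_mult ennreal_mult ennreal_inverse_mult)

lemma sing_minus [simp]: "sing s (- x) = sing s x"
  by (simp add: sing_def)

lemma sing_antimono: "\<bar>x\<bar> \<le> \<bar>y\<bar> \<Longrightarrow> s \<ge> 0 \<Longrightarrow> sing s y \<le> sing s x"
  by (cases "x = 0") (auto simp: sing_nonzero intro!: ennreal_leI powr_mono2')

lemma sing_le_1: "1 \<le> \<bar>x\<bar> \<Longrightarrow> s \<ge> 0 \<Longrightarrow> sing s x \<le> 1"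
  using sing_antimono[of 1 x s] by (simp add: sing_def)

lemma sing_integrable_near_0:
  assumes "0 < s" "s < 1"
  shows "(\<integral>\<^sup>+x\<in>{-1..1}. sing s x \<partial>lborel) < \<infinity>"
proof -
  have I: "((\<lambda>x. x powr - s) has_integral (1 powr (- s + 1) / (- s + 1))) {0..1::real}"
    by (rule has_integral_powr_from_0) (use assms in auto)
  have P: "(\<integral>\<^sup>+x. sing s x * indicator {0..1} x \<partial>lborel) < \<infinity>"
  proof -
    have "(\<integral>\<^sup>+x. sing s x * indicator {0..1} x \<partial>lborel)
        = (\<integral>\<^sup>+x. ennreal ((x powr - s) * indicator {0..1} x) \<partial>lborel)"
    proof (rule nn_integral_cong_AE)
      show "AE x in lborel. sing s x * indicator {0..1} x = ennreal ((x powr - s) * indicator {0..1} x)"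
        using AE_lborel_singleton[of 0]
        by eventually_elim (auto simp: sing_nonzero indicator_def)
    qed
    also have "\<dots> = ennreal (1 powr (- s + 1) / (- s + 1))"
    proof (rule nn_integral_has_integral_lborel)
      show "((\<lambda>x. x powr - s * indicator {0..1} x) has_integral 1 powr (- s + 1) / (- s + 1)) UNIV"
        using I unfolding has_integral_restrict_UNIV[symmetric, of _ _ "{0..1}"]
        by (rule has_integral_eq[rotated]) (auto simp: indicator_def)
    qed (auto simp: indicator_def)
    finally show ?thesis by simp
  qed
  have "(\<integral>\<^sup>+x. sing s x * indicator {0..1} x \<partial>lborel)
      = (\<integral>\<^sup>+x. sing s x * indicator {-1..0} x \<partial>lborel)"
    by (subst nn_integral_real_affine[where c="-1" and t=0])
       (auto intro!: nn_integral_cong simp: indicator_def)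
  then have N: "(\<integral>\<^sup>+x. sing s x * indicator {-1..0} x \<partial>lborel) < \<infinity>"
    using P by simp
  have "(\<integral>\<^sup>+x\<in>{-1..1}. sing s x \<partial>lborel)
      \<le> (\<integral>\<^sup>+x. sing s x * indicator {-1..0} x + sing s x * indicator {0..1} x \<partial>lborel)"
    by (intro nn_integral_mono) (auto simp: indicator_def)
  also have "\<dots> < \<infinity>"
    using P N by (subst nn_integral_add) auto
  finally show ?thesis .
qed

abbreviation "unif \<equiv> uniform_measure lborel {0..1::real}"

lemma prob_space_unif: "prob_space unif"
  by (rule prob_space_uniform_measure) auto

text \<open>Scaling \<open>m\<close> out leaves \<open>sing s\<close> over an interval of length 1:
  the part within [-1, 1] contributes at most \<open>J\<close>, and elsewhere \<open>sing s\<close>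
  is at most 1. The bound is uniform in \<open>c\<close>. At \<open>m = 0\<close> the right-hand
  side is infinite because \<open>0 < K\<close>.\<close>

lemma unif_sing_le:
  assumes "0 < s" "s < 1"
  obtains K where "0 < K" "K < \<infinity>"
    "\<And>m c. (\<integral>\<^sup>+x. sing s (x * m + c) \<partial>unif) \<le> K * sing s m"
proof
  define J where "J = (\<integral>\<^sup>+x\<in>{-1..1}. sing s x \<partial>lborel)"
  show "0 < 1 + J" by (simp add: add_pos_nonneg)
  show "1 + J < \<infinity>" using sing_integrable_near_0[OF assms] by (simp add: J_def)
  fix m c :: real
  show "(\<integral>\<^sup>+x. sing s (x * m + c) \<partial>unif) \<le> (1 + J) * sing s m"
  proof (cases "m = 0")
    case True
    then show ?thesis by (simp add: ennreal_mult_top add_pos_nonneg)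
  next
    case False
    define a where "a = c / m"
    have "(\<integral>\<^sup>+x. sing s (x * m + c) \<partial>unif) = (\<integral>\<^sup>+x\<in>{0..1}. sing s (x * m + c) \<partial>lborel)"
      by (subst nn_integral_uniform_measure) (auto simp: divide_ennreal_def)
    also have "\<dots> = (\<integral>\<^sup>+x. sing s m * (sing s (x + a) * indicator {0..1} x) \<partial>lborel)"
    proof (intro nn_integral_cong)
      fix x
      have "x * m + c = m * (x + a)" using False by (simp add: a_def field_simps)
      then show "sing s (x * m + c) * indicator {0..1} x = sing s m * (sing s (x + a) * indicator {0..1} x)"
        by (simp add: sing_mult mult.assoc)
    qed
    also have "\<dots> = sing s m * (\<integral>\<^sup>+x. (sing s (x + a) * indicator {0..1} x) \<partial>lborel)"
      by (rule nn_integral_cmult) measurable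
    finally have eq: "(\<integral>\<^sup>+x. sing s (x * m + c) \<partial>unif)
        = sing s m * (\<integral>\<^sup>+x. (sing s (x + a) * indicator {0..1} x) \<partial>lborel)" .
    have "(\<integral>\<^sup>+x. (sing s (x + a) * indicator {0..1} x) \<partial>lborel)
       \<le> (\<integral>\<^sup>+x. indicator {0..1} x + sing s (a + 1 * x) * indicator {-1..1} (a + 1 * x) \<partial>lborel)"
    proof (intro nn_integral_mono)
      fix x
      show "sing s (x + a) * indicator {0..1} x
        \<le> indicator {0..1} x + sing s (a + 1 * x) * indicator {-1..1} (a + 1 * x)"
        using sing_le_1[of "a + x" s] assms
        by (cases "\<bar>a + x\<bar> \<le> 1") (auto simp: indicator_def add.commute)
    qed
    also have "\<dots> = 1 + (\<integral>\<^sup>+x. sing s (a + 1 * x) * indicator {-1..1} (a + 1 * x) \<partial>lborel)"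
      by (subst nn_integral_add) auto
    also have "(\<integral>\<^sup>+x. sing s (a + 1 * x) * indicator {-1..1} (a + 1 * x) \<partial>lborel) = J"
      unfolding J_def
      by (subst (2) nn_integral_real_affine[where c=1 and t=a]) (auto)
    finally show ?thesis
      unfolding eq by (subst mult.commute) (intro mult_right_mono, auto)
  qed
qed

section \<open>Random points of the unit cube\<close>

abbreviation cube :: "('n::finite \<Rightarrow> real) measure" where
  "cube \<equiv> PiM UNIV (\<lambda>_. unif)"

interpretation cube: product_prob_space "\<lambda>_::'n::finite. unif" UNIV
  by (intro product_prob_spaceI prob_space_unif)

text \<open>Integrating first over a coordinate \<open>j\<close> at which \<open>v\<close> attains
  its maximum norm reduces this to one variable; the other coordinates only change the shift, and
  the one-variable bound is uniform in shifts.\<close>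

lemma cube_sing_le:
  assumes "0 < s" "s < 1"
  obtains K where "0 < K" "K < \<infinity>"
    "\<And>(v::real^'n) c. (\<integral>\<^sup>+f. sing s (vec_lambda f \<bullet> v + c) \<partial>cube) \<le> K * sing s (infnorm v)"
proof -
  obtain K where K: "0 < K" "K < \<infinity>"
    "\<And>m c. (\<integral>\<^sup>+x. sing s (x * m + c) \<partial>unif) \<le> K * sing s m"
    using unif_sing_le[OF assms] by metis
  have "(\<integral>\<^sup>+f. sing s (vec_lambda f \<bullet> v + c) \<partial>cube) \<le> K * sing s (infnorm v)" for v :: "real^'n" and c
  proof -
    obtain j where j: "infnorm v = \<bar>v $ j\<bar>"
    proof -
      have "(MAX i. \<bar>v $ i\<bar>) \<in> range (\<lambda>i. \<bar>v $ i\<bar>)" by (intro Max_in) auto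
      then show ?thesis using that by (auto simp: infnorm_eq_Max[of v] image_iff)
    qed
    define I where "I = UNIV - {j}"
    have I: "finite I" "j \<notin> I" "UNIV = insert j I" by (auto simp: I_def)
    have inner: "vec_lambda f \<bullet> v = f j * v $ j + (\<Sum>i\<in>I. f i * v $ i)" for f
      by (simp add: inner_vec_def I_def sum.remove[of UNIV j])
    interpret PI: prob_space "PiM I (\<lambda>_. unif)"
      by (intro prob_space_PiM prob_space_unif)
    have meas: "(\<lambda>f. sing s (vec_lambda f \<bullet> v + c)) \<in> borel_measurable (PiM (insert j I) (\<lambda>_. unif))"
      unfolding inner by measurable
    have "(\<integral>\<^sup>+f. sing s (vec_lambda f \<bullet> v + c) \<partial>cube)
        = (\<integral>\<^sup>+ f. (\<integral>\<^sup>+ y. sing s (vec_lambda (f(j := y)) \<bullet> v + c) \<partial>unif) \<partial>(PiM I (\<lambda>_. unif)))"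
      unfolding I(3) by (rule cube.product_nn_integral_insert[OF I(1,2) meas])
    also have "\<dots> \<le> (\<integral>\<^sup>+ f. K * sing s (v $ j) \<partial>(PiM I (\<lambda>_. unif)))"
    proof (intro nn_integral_mono)
      fix f :: "'n \<Rightarrow> real"
      have "(\<Sum>i\<in>I. (f(j := y)) i * v $ i) = (\<Sum>i\<in>I. f i * v $ i)" for y
        using I by (intro sum.cong) auto
      then have "(\<integral>\<^sup>+ y. sing s (vec_lambda (f(j := y)) \<bullet> v + c) \<partial>unif)
         = (\<integral>\<^sup>+ y. sing s (y * v $ j + ((\<Sum>i\<in>I. f i * v $ i) + c)) \<partial>unif)"
        by (simp add: inner add.assoc)
      then show "(\<integral>\<^sup>+ y. sing s (vec_lambda (f(j := y)) \<bullet> v + c) \<partial>unif) \<le> K * sing s (v $ j)"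
        using K(3) by simp
    qed
    also have "\<dots> = K * sing s (infnorm v)"
      by (simp add: PI.emeasure_space_1 j sing_def)
    finally show ?thesis .
  qed
  then show ?thesis using K that by blast
qed

text \<open>By Tonelli the mean of the sum is at most \<open>K\<close> times the sum assumed finite,
  so the sum is almost surely finite. The shifts \<open>c z\<close> leave room for a part of the
  form that is not random.\<close>

lemma AE_cube_sum_sing:
  fixes v :: "'a \<Rightarrow> real^'n"
  assumes "0 < s" "s < 1" "countable Z"
    and fin: "(\<integral>\<^sup>+z. w z * sing s (infnorm (v z)) \<partial>count_space Z) < \<infinity>"
  shows "AE f in cube. (\<integral>\<^sup>+z. w z * sing s (vec_lambda f \<bullet> v z + c z) \<partial>count_space Z) < \<infinity>"
proof -
  obtain K where K: "0 < K" "K < \<infinity>"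
    "\<And>(v::real^'n) c. (\<integral>\<^sup>+f. sing s (vec_lambda f \<bullet> v + c) \<partial>cube) \<le> K * sing s (infnorm v)"
    using cube_sing_le[OF assms(1,2)] by metis
  have m: "(\<lambda>f. sing s (vec_lambda f \<bullet> v z + c z)) \<in> borel_measurable cube" for z
    unfolding inner_vec_def vec_lambda_beta inner_real_def by measurable
  have meas: "(\<lambda>f. \<integral>\<^sup>+z. w z * sing s (vec_lambda f \<bullet> v z + c z) \<partial>count_space Z) \<in> borel_measurable cube"
    (is "?F \<in> _")
  proof (rule sigma_finite_measure.borel_measurable_nn_integral)
    show "sigma_finite_measure (count_space Z)"
      using assms(3) by (rule sigma_finite_measure_count_space_countable)
    \<comment> \<open>As \<open>Z\<close> is countable, joint measurability reduces to measurability
      in \<open>f\<close> for each fixed \<open>z\<close>.\<close>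
    have "(\<lambda>p. w (snd p) * sing s (vec_lambda (fst p) \<bullet> v (snd p) + c (snd p)))
        \<in> borel_measurable (cube \<Otimes>\<^sub>M count_space Z)"
      by (rule measurable_compose_countable'[where I=Z and g=snd and
            f="\<lambda>z p. w z * sing s (vec_lambda (fst p) \<bullet> v z + c z)"])
         (use assms(3) measurable_compose[OF measurable_fst m] in \<open>auto intro!: borel_measurable_times_ennreal\<close>)
    then show "(\<lambda>(f, z). w z * sing s (vec_lambda f \<bullet> v z + c z))
        \<in> borel_measurable (cube \<Otimes>\<^sub>M count_space Z)"
      by (simp add: case_prod_beta')
  qed
  have "(\<integral>\<^sup>+f. ?F f \<partial>cube)
      = (\<integral>\<^sup>+z. \<integral>\<^sup>+f. w z * sing s (vec_lambda f \<bullet> v z + c z) \<partial>cube \<partial>count_space Z)"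
    using m by (intro nn_integral_count_space_nn_integral assms borel_measurable_times_ennreal) auto
  also have "\<dots> \<le> (\<integral>\<^sup>+z. K * (w z * sing s (infnorm (v z))) \<partial>count_space Z)"
  proof (intro nn_integral_mono)
    fix z
    have "(\<integral>\<^sup>+f. w z * sing s (vec_lambda f \<bullet> v z + c z) \<partial>cube)
       = w z * (\<integral>\<^sup>+f. sing s (vec_lambda f \<bullet> v z + c z) \<partial>cube)"
      by (intro nn_integral_cmult m)
    also have "\<dots> \<le> w z * (K * sing s (infnorm (v z)))"
      by (intro mult_left_mono K) auto
    finally show "(\<integral>\<^sup>+f. w z * sing s (vec_lambda f \<bullet> v z + c z) \<partial>cube) \<le> K * (w z * sing s (infnorm (v z)))"
      by (simp add: mult_ac)
  qed
  also have "\<dots> = K * (\<integral>\<^sup>+z. w z * sing s (infnorm (v z)) \<partial>count_space Z)"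
    by (intro nn_integral_cmult) auto
  also have "\<dots> < \<infinity>" using fin K by (simp add: ennreal_mult_less_top)
  finally have "AE f in cube. ?F f \<noteq> \<infinity>"
    by (intro nn_integral_PInf_AE meas) auto
  then show ?thesis by (simp add: less_top)
qed

section \<open>A number of prescribed order of approximation\<close>

lemma exists_exactly_approximable:
  fixes \<tau> :: real
  assumes "\<tau> \<ge> 2"
  obtains \<alpha> c :: real where "c > 0"
    "\<And>p q :: int. (p, q) \<noteq> (0, 0) \<Longrightarrow> c * real_of_int (max \<bar>p\<bar> \<bar>q\<bar>) powr - \<tau> \<le> \<bar>p - \<alpha> * q\<bar>"
    "\<And>N::nat. \<exists>p q :: int. q > int N \<and> \<bar>p\<bar> \<le> q \<and> \<bar>p - \<alpha> * q\<bar> \<le> 4 * real_of_int q powr - \<tau>"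
proof -
  txt \<open>\<open>\<alpha>\<close> is the sum of the \<open>1 / Q k\<close>, where \<open>Q k\<close> is a power of 2 and \<open>Q (Suc k)\<close> is about
    \<open>Q k powr (\<tau> + 1)\<close>; the partial sums \<open>P k / Q k\<close> are its only approximations of order better than 2.\<close>
  define n where "n = rec_nat (1::nat) (\<lambda>_ m. nat \<lceil>(\<tau> + 1) * m\<rceil>)"
  have n0 [simp]: "n 0 = 1" and nS: "n (Suc k) = nat \<lceil>(\<tau> + 1) * n k\<rceil>" for k
    by (simp_all add: n_def)
  have nS_ge: "(\<tau> + 1) * n k \<le> n (Suc k)" and nS_le: "n (Suc k) \<le> (\<tau> + 1) * n k + 1" for k
    using assms unfolding nS by (simp_all add: of_nat_nat)
  have n3: "3 * n k \<le> n (Suc k)" for k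
  proof -
    have "3 * real (n k) \<le> (\<tau> + 1) * n k" using assms by (intro mult_right_mono) auto
    also note nS_ge[of k]
    finally show ?thesis by linarith
  qed
  have npos: "n k \<ge> 1" for k
  proof (induction k)
    case (Suc k) then show ?case using n3[of k] by linarith
  qed simp
  have n_ge: "n k \<ge> Suc k" for k
  proof (induction k)
    case (Suc k) then show ?case using n3[of k] by linarith
  qed auto
  define Q :: "nat \<Rightarrow> real" where "Q k = 2 ^ n k" for k
  have Qpos [simp]: "Q k > 0" for k by (simp add: Q_def)
  have Qge [simp]: "Q k \<ge> 0" for k by (simp add: Q_def)
  have Qne [simp]: "Q k \<noteq> 0" for k by (simp add: Q_def)
  have Q2: "Q k \<ge> 2" for k
    using power_increasing[of 1 "n k" "2::real"] npos[of k] by (simp add: Q_def)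
  have Qk: "Q k powr (\<tau> + 1) \<le> Q (Suc k)" "Q (Suc k) \<le> 2 * Q k powr (\<tau> + 1)" for k
  proof -
    have *: "Q j = 2 powr n j" for j by (simp add: Q_def powr_realpow)
    have "Q k powr (\<tau> + 1) = 2 powr ((\<tau> + 1) * n k)" by (simp add: * powr_powr powr_add algebra_simps)
    then show "Q k powr (\<tau> + 1) \<le> Q (Suc k)"
      using nS_ge[of k] by (simp add: *)
    have "Q (Suc k) \<le> 2 powr ((\<tau> + 1) * n k + 1)"
      using nS_le[of k] by (simp add: *)
    also have "\<dots> = 2 * Q k powr (\<tau> + 1)" by (simp add: * powr_powr powr_add algebra_simps)
    finally show "Q (Suc k) \<le> 2 * Q k powr (\<tau> + 1)" .
  qed
  have Qj: "2 ^ j * Q k \<le> Q (j + k)" for j k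
  proof (induction j)
    case (Suc j)
    have "2 * Q (j + k) = 2 ^ (Suc (n (j + k)))" by (simp add: Q_def)
    also have "\<dots> \<le> Q (Suc (j + k))"
      unfolding Q_def using n3[of "j + k"] npos[of "j + k"] by (intro power_increasing) auto
    finally show ?case using Suc by simp
  qed simp
  have tail: "summable (\<lambda>j. 1 / Q (j + k))" "(\<Sum>j. 1 / Q (j + k)) \<le> 2 / Q k" for k
  proof -
    have le: "1 / Q (j + k) \<le> (1/2) ^ j * (1 / Q k)" for j
      using Qj[of j k] Qpos[of k] Qpos[of "j + k"]
      by (simp add: power_divide divide_simps mult.commute)
    have g: "summable (\<lambda>j. (1/2) ^ j * (1 / Q k))"
      by (intro summable_mult2 summable_geometric) auto
    show s: "summable (\<lambda>j. 1 / Q (j + k))"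
      by (rule summable_comparison_test'[OF g, of 0]) (use le in \<open>auto simp: Qpos less_imp_le\<close>)
    have "(\<Sum>j. 1 / Q (j + k)) \<le> (\<Sum>j. (1/2) ^ j * (1 / Q k))"
      by (intro suminf_le le s g)
    also have "\<dots> = (\<Sum>j. (1/2) ^ j) * (1 / Q k)"
      by (intro suminf_mult2[symmetric] summable_geometric) auto
    also have "\<dots> = 2 / Q k" by (subst suminf_geometric) auto
    finally show "(\<Sum>j. 1 / Q (j + k)) \<le> 2 / Q k" .
  qed
  define \<alpha> where "\<alpha> = (\<Sum>j. 1 / Q j)"
  define P where "P = rec_nat (1::int) (\<lambda>k m. m * 2 ^ (n (Suc k) - n k) + 1)"
  have P0: "P 0 = 1" and PS: "P (Suc k) = P k * 2 ^ (n (Suc k) - n k) + 1" for k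
    by (simp_all add: P_def)
  have Psum: "real_of_int (P k) / Q k = (\<Sum>j<Suc k. 1 / Q j)" for k
  proof (induction k)
    case (Suc k)
    have "Q (Suc k) = 2 ^ (n (Suc k) - n k) * Q k"
      using n3[of k] by (simp add: Q_def flip: power_add)
    then have "real_of_int (P (Suc k)) / Q (Suc k) = P k / Q k + 1 / Q (Suc k)"
      using Qpos[of k] by (simp add: PS add_divide_distrib Q_def)
    then show ?case using Suc by simp
  qed (simp add: P0)
  \<comment> \<open>Since \<open>Q k\<close> is a power of 2, this says that the fraction
    \<open>P k / Q k\<close> is reduced.\<close>
  have Podd: "odd (P k)" for k
  proof (cases k)
    case (Suc j)
    then show ?thesis using n3[of j] npos[of j] by (simp add: PS)
  qed (simp add: P0)
  have split: "\<alpha> - P k / Q k = (\<Sum>j. 1 / Q (j + Suc k))" for k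
    using suminf_split_initial_segment[OF tail(1)[of 0, simplified], of "Suc k"]
    unfolding \<alpha>_def Psum by simp
  have up: "\<alpha> - P k / Q k \<le> 2 / Q (Suc k)" for k
    unfolding split using tail(2)[of "Suc k"] .
  have lo: "1 / Q (Suc k) \<le> \<alpha> - P k / Q k" for k
    unfolding split
    using sum_le_suminf[OF tail(1)[of "Suc k"], of "{0}"] by (simp add: less_imp_le)
  \<comment> \<open>This yields \<open>P k \<le> Q k\<close>, so that the maximum norm of the pair
    \<open>(P k, Q k)\<close> is its denominator.\<close>
  have "\<alpha> \<le> 1"
  proof -
    have "2 / Q (Suc 0) \<le> 2 / 8"
      using n3[of 0] power_increasing[of 3 "n (Suc 0)" "2::real"]
      by (intro divide_left_mono) (auto simp: Q_def)
    moreover have "\<alpha> - 1 / 2 \<le> 2 / Q (Suc 0)" using up[of 0] by (simp add: P0 Q_def)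
    ultimately show ?thesis by linarith
  qed
  have PleQ: "real_of_int (P k) \<le> Q k" for k
  proof -
    have "P k / Q k \<le> 1" using lo[of k] \<open>\<alpha> \<le> 1\<close> Qpos[of "Suc k"]
      by (smt (verit) divide_pos_pos)
    then show ?thesis by simp
  qed
  have Ppos: "P k \<ge> 0" for k by (induction k) (simp_all add: P0 PS)
  \<comment> \<open>The partial sum with index \<open>N\<close> serves: its denominator exceeds
    \<open>N\<close>, its error is at most \<open>2 / Q (Suc N)\<close>, and multiplying by
    \<open>Q N\<close> lowers the order \<tau> + 1 to \<tau>.\<close>
  have infm: "\<exists>p q :: int. q > int N \<and> \<bar>p\<bar> \<le> q \<and> \<bar>p - \<alpha> * q\<bar> \<le> 4 * real_of_int q powr - \<tau>" for N
  proof (rule exI[of _ "P N"], rule exI[of _ "2 ^ n N"], intro conjI)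
    have "int N < int (n N)" using n_ge[of N] by linarith
    also have "\<dots> < int (2 ^ n N)" using less_exp[of "n N"] by linarith
    finally show "int N < 2 ^ n N" by simp
    show "\<bar>P N\<bar> \<le> 2 ^ n N"
      using PleQ[of N] Ppos[of N] unfolding Q_def
      by (metis abs_of_nonneg of_int_le_iff of_int_numeral of_int_power)
    have "\<bar>P N - \<alpha> * Q N\<bar> = (\<alpha> - P N / Q N) * Q N"
    proof -
      have "(\<alpha> - P N / Q N) * Q N = - (P N - \<alpha> * Q N)" using Qpos[of N] by (simp add: field_simps)
      moreover have "0 \<le> (\<alpha> - P N / Q N) * Q N"
        using lo[of N] Qpos[of N] Qpos[of "Suc N"] by (smt (verit) divide_pos_pos mult_nonneg_nonneg)
      ultimately show ?thesis by (metis abs_minus_cancel abs_of_nonneg)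
    qed
    also have "\<dots> \<le> 2 / Q (Suc N) * Q N" using up[of N] by (intro mult_right_mono) (auto simp: less_imp_le)
    also have "\<dots> \<le> 2 / Q N powr (\<tau> + 1) * Q N"
      using Qk(1)[of N] by (intro mult_right_mono divide_left_mono) (auto simp: less_imp_le)
    also have "\<dots> = 2 * Q N powr - \<tau>"
      using Qpos[of N] by (simp add: powr_add powr_minus field_simps)
    also have "\<dots> \<le> 4 * Q N powr - \<tau>" by simp
    finally show "\<bar>P N - \<alpha> * real_of_int (2 ^ n N)\<bar> \<le> 4 * real_of_int (2 ^ n N) powr - \<tau>"
      by (simp add: Q_def)
  qed
  have pos: "1 / 16 * real_of_int q powr - \<tau> \<le> \<bar>p - \<alpha> * q\<bar>" if "q > 0" for p q :: int
  proof -
    define q' where "q' = real_of_int q"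
    have q1: "q' \<ge> 1" using that by (simp add: q'_def)
    \<comment> \<open>The cube comes from \<tau> \<ge> 2, through \<open>n3\<close>.\<close>
    have Qsq: "Q j * Q j * Q j \<le> Q (Suc j)" for j
    proof -
      have "Q j * Q j * Q j = 2 ^ (3 * n j)"
        unfolding Q_def by (simp flip: power_add)
      then show ?thesis using power_increasing[OF n3[of j], of "2::real"] by (simp add: Q_def)
    qed
    txt \<open>For the first \<open>k\<close> with \<open>4 * q * Q k \<le> Q (Suc k)\<close>, replacing \<open>\<alpha>\<close> by \<open>P k / Q k\<close> costs at most half
      of the distance \<open>1 / Q k\<close> between \<open>p\<close> and \<open>q * P k / Q k\<close>, unless \<open>p / q = P k / Q k\<close>.\<close>
    have ex: "\<exists>k. 4 * q' * Q k \<le> Q (Suc k)"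
    proof
      define k where "k = nat q"
      have "q' = real k" using that by (simp add: q'_def k_def)
      also have "real k \<le> 2 ^ k" using less_exp[of k] by (metis less_imp_le of_nat_le_iff of_nat_numeral of_nat_power)
      finally have "4 * q' \<le> 2 * (2 * 2 ^ k)" by simp
      also have "\<dots> \<le> Q k * Q k"
      proof (intro mult_mono)
        show "2 * 2 ^ k \<le> Q k"
          unfolding Q_def power_Suc[symmetric] using n_ge[of k] by (intro power_increasing) auto
      qed (use Q2 in auto)
      finally have "4 * q' * Q k \<le> Q k * Q k * Q k" by (intro mult_right_mono) (auto simp: less_imp_le)
      then show "4 * q' * Q k \<le> Q (Suc k)" using Qsq[of k] by linarith
    qed
    define k where "k = (LEAST k. 4 * q' * Q k \<le> Q (Suc k))"
    have k: "4 * q' * Q k \<le> Q (Suc k)"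
      unfolding k_def by (rule LeastI_ex[OF ex])
    \<comment> \<open>If \<open>k = Suc j\<close>, minimality gives
      \<open>Q k < 4 * q' * Q j\<close>. As \<open>Q k\<close> is at least the cube of
      \<open>Q j\<close>, the square of \<open>Q j\<close> is below \<open>4 * q'\<close>, whence
      \<open>Q j \<le> 2 * q'\<close>.\<close>
    have Qk8: "Q k \<le> 8 * q' ^ 2"
    proof (cases k)
      case 0
      have "1 \<le> q'^2" using q1 by simp
      then show ?thesis using 0 by (simp add: Q_def)
    next
      case (Suc j)
      then have j: "Q k < 4 * q' * Q j"
        using not_less_Least[of j "\<lambda>k. 4 * q' * Q k \<le> Q (Suc k)"] by (simp add: k_def[symmetric])
      have "Q j * Q j * Q j < 4 * q' * Q j" using Qsq[of j] j unfolding Suc by (rule le_less_trans)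
      then have "Q j * Q j < 4 * q'" by simp
      moreover have "2 * Q j \<le> Q j * Q j" using Q2[of j] by (intro mult_right_mono) auto
      ultimately have "Q j \<le> 2 * q'" by linarith
      then have "4 * q' * Q j \<le> 4 * q' * (2 * q')" using q1 by (intro mult_left_mono) auto
      then show ?thesis using j by (simp add: power2_eq_square)
    qed
    have "1 / 16 * q' powr - \<tau> \<le> \<bar>p - \<alpha> * q'\<bar>"
    proof (cases "p * 2 ^ n k = q * P k")
      case False
      have "1 \<le> \<bar>real_of_int (p * 2 ^ n k - q * P k)\<bar>"
        using False by (metis eq_iff_diff_eq_0 of_int_1 of_int_abs of_int_le_iff zero_less_abs_iff int_one_le_iff_zero_less)
      also have "\<dots> = \<bar>p * Q k - q' * P k\<bar>" by (simp add: Q_def q'_def)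
      finally have "1 / Q k \<le> \<bar>p * Q k - q' * P k\<bar> / Q k"
        by (intro divide_right_mono) (auto simp: less_imp_le)
      also have "\<dots> = \<bar>(p * Q k - q' * P k) / Q k\<bar>" using Qpos[of k] by (simp del: Qpos)
      also have "(p * Q k - q' * P k) / Q k = p - q' * (P k / Q k)"
        using Qpos[of k] by (simp add: field_simps)
      finally have 1: "1 / Q k \<le> \<bar>p - q' * (P k / Q k)\<bar>" .
      have "q' * (\<alpha> - P k / Q k) \<le> q' * (2 / Q (Suc k))" using up[of k] q1 by (intro mult_left_mono) auto
      also have "\<dots> \<le> q' * (2 / (4 * q' * Q k))"
        using k q1 by (intro mult_left_mono divide_left_mono) auto
      also have "\<dots> = 1 / (2 * Q k)" using q1 by (simp add: field_simps)
      finally have 2: "q' * (\<alpha> - P k / Q k) \<le> 1 / (2 * Q k)" .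
      have 3: "0 \<le> q' * (\<alpha> - P k / Q k)"
        using lo[of k] Qpos[of "Suc k"] q1 by (smt (verit) divide_pos_pos mult_nonneg_nonneg)
      \<comment> \<open>Half of the gap \<open>1 / Q k\<close> survives, and by \<open>Qk8\<close>
        it is at least \<open>1 / (16 * q'^2)\<close>. This is the source of the constant 1/16, and
        \<tau> \<ge> 2 is what makes it enough.\<close>
      have "1 / 16 * q' powr - \<tau> \<le> 1 / 16 * q' powr - 2"
        using q1 assms by (intro mult_left_mono powr_mono) auto
      also have "\<dots> = 1 / (2 * (8 * q'^2))" using q1 by (simp add: powr_minus_divide)
      also have "\<dots> \<le> 1 / (2 * Q k)" using Qk8 q1 by (intro divide_left_mono) auto
      also have "\<dots> = 1 / Q k - 1 / (2 * Q k)" using Qpos[of k] by (simp add: field_simps)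
      also have "\<dots> \<le> \<bar>p - q' * (P k / Q k)\<bar> - q' * (\<alpha> - P k / Q k)" using 1 2 by linarith
      also have "\<dots> \<le> \<bar>p - \<alpha> * q'\<bar>" using 3 by (simp add: algebra_simps)
      finally show ?thesis .
    next
      case True
      \<comment> \<open>Here \<open>p / q\<close> equals the reduced fraction
        \<open>P k / Q k\<close>, so \<open>Q k\<close> divides \<open>q\<close>. The error of that
        fraction is at least \<open>1 / Q (Suc k)\<close>, which is comparable to
        \<open>Q k powr - (\<tau> + 1)\<close>, and \<open>Q k \<le> q'\<close> gives the required
        size.\<close>
      have "coprime (2 ^ n k) (P k)" using Podd[of k] by simp
      moreover have "2 ^ n k dvd q * P k" using True by (metis dvd_triv_right)
      ultimately have "2 ^ n k dvd q" by (simp add: coprime_dvd_mult_left_iff)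
      then have "2 ^ n k \<le> q" using that by (rule zdvd_imp_le)
      then have Qq: "Q k \<le> q'" unfolding Q_def q'_def
        by (metis of_int_le_iff of_int_numeral of_int_power)
      have "p * Q k = q' * P k" using True unfolding Q_def q'_def
        by (metis of_int_mult of_int_numeral of_int_power)
      then have "real_of_int p = q' * (P k / Q k)" using Qpos[of k] by (simp add: field_simps del: Qpos)
      then have eq: "p - \<alpha> * q' = - (q' * (\<alpha> - P k / Q k))" by (simp add: algebra_simps)
      have "1 / 16 * q' powr - \<tau> \<le> 1 / 2 * q' powr - \<tau>" by simp
      also have "\<dots> = q' * (1 / (2 * q' powr (\<tau> + 1)))"
        using q1 by (simp add: powr_add powr_minus field_simps)
      also have "\<dots> \<le> q' * (1 / (2 * Q k powr (\<tau> + 1)))"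
        using q1 Qq assms Qpos[of k]
        by (intro mult_left_mono divide_left_mono powr_mono2 mult_pos_pos) (auto simp: less_imp_le)
      also have "\<dots> \<le> q' * (1 / Q (Suc k))"
        using q1 Qk(2)[of k] by (intro mult_left_mono divide_left_mono) auto
      also have "\<dots> \<le> q' * (\<alpha> - P k / Q k)" using lo[of k] q1 by (intro mult_left_mono) auto
      also have "\<dots> \<le> \<bar>p - \<alpha> * q'\<bar>" unfolding eq by simp
      finally show ?thesis .
    qed
    then show ?thesis by (simp add: q'_def)
  qed
  show thesis
  proof (rule that[of "1/16" \<alpha>])
    fix p q :: int assume nz: "(p, q) \<noteq> (0, 0)"
    define m where "m = real_of_int (max \<bar>p\<bar> \<bar>q\<bar>)"
    have mono: "m powr - \<tau> \<le> \<bar>real_of_int q\<bar> powr - \<tau>" if "q \<noteq> 0"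
      using that assms by (intro powr_mono2') (auto simp: m_def)
    show "1/16 * m powr - \<tau> \<le> \<bar>p - \<alpha> * q\<bar>"
    proof (cases "q = 0")
      case True
      then have "m \<ge> 1" "\<bar>real_of_int p\<bar> \<ge> 1" using nz by (auto simp: m_def)
      moreover from this have "m powr - \<tau> \<le> 1" using assms
        using powr_mono[of "-\<tau>" 0 m] by simp
      ultimately show ?thesis using True by simp
    next
      case False
      have "1/16 * real_of_int \<bar>q\<bar> powr - \<tau> \<le> \<bar>sgn q * p - \<alpha> * \<bar>q\<bar>\<bar>"
        using pos[of "\<bar>q\<bar>" "sgn q * p"] False by simp
      also have "\<bar>sgn q * p - \<alpha> * \<bar>q\<bar>\<bar> = \<bar>p - \<alpha> * q\<bar>"
        using False by (cases "q > 0") (auto simp: sgn_if abs_if)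
      finally show ?thesis using mono[OF False] by simp
    qed
  qed (use infm in auto)
qed

section \<open>Sums of negative powers of a linear form\<close>

lemma ennreal_le_suminf: "f k \<le> (\<Sum>k. f k :: ennreal)"
  using sum_le_suminf[of f "{k}"] by simp

lemma nn_integral_count_space_restrict:
  assumes "A \<subseteq> B"
  shows "(\<integral>\<^sup>+x. f x * indicator A x \<partial>count_space B) = (\<integral>\<^sup>+x. f x \<partial>count_space A)"
proof -
  have "(\<integral>\<^sup>+x. f x * indicator A x \<partial>count_space B)
      = (\<integral>\<^sup>+x. (f x * indicator A x) * indicator B x \<partial>count_space UNIV)"
    by (subst nn_integral_count_space_indicator) auto
  also have "\<dots> = (\<integral>\<^sup>+x. f x * indicator A x \<partial>count_space UNIV)"
    using assms by (intro nn_integral_cong) (auto simp: indicator_def)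
  also have "\<dots> = (\<integral>\<^sup>+x. f x \<partial>count_space A)"
    by (subst (2) nn_integral_count_space_indicator) auto
  finally show ?thesis .
qed

lemma nn_integral_count_space_le_injection:
  assumes "inj_on f S" "f ` S \<subseteq> T" "\<And>x. x \<in> S \<Longrightarrow> g x \<le> h (f x)"
  shows "(\<integral>\<^sup>+x. g x \<partial>count_space S) \<le> (\<integral>\<^sup>+y. h y \<partial>count_space T)"
proof -
  have "(\<integral>\<^sup>+x. g x \<partial>count_space S) \<le> (\<integral>\<^sup>+x. h (f x) \<partial>count_space S)"
    using assms(3) by (intro nn_integral_mono) auto
  also have "\<dots> = (\<integral>\<^sup>+y. h y \<partial>count_space (f ` S))"
    using assms(1) by (intro nn_integral_bij_count_space inj_on_imp_bij_betw)
  also have "\<dots> = (\<integral>\<^sup>+y. h y * indicator (f ` S) y \<partial>count_space T)"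
    using assms(2) by (rule nn_integral_count_space_restrict[symmetric])
  also have "\<dots> \<le> (\<integral>\<^sup>+y. h y \<partial>count_space T)"
    by (intro nn_integral_mono) (auto simp: indicator_def)
  finally show ?thesis .
qed

lemma abs_summable_int_powr:
  assumes "a > 1"
  shows "Infinite_Set_Sum.abs_summable_on (\<lambda>k::int. (1 + \<bar>real_of_int k\<bar>) powr - a) UNIV"
proof -
  have s: "Infinite_Set_Sum.abs_summable_on (\<lambda>n::nat. (1 + real n) powr - a) UNIV"
  proof -
    have "summable (\<lambda>n. real (Suc n) powr - a)"
      using assms by (subst summable_Suc_iff) (simp add: summable_real_powr_iff)
    then show ?thesis
      by (simp add: abs_summable_on_nat_iff' add.commute)
  qed
  have "Infinite_Set_Sum.abs_summable_on (\<lambda>k::int. (1 + \<bar>real_of_int k\<bar>) powr - a) (range int)"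
    using s by (subst abs_summable_on_reindex_iff[symmetric]) auto
  moreover have "Infinite_Set_Sum.abs_summable_on (\<lambda>k::int. (1 + \<bar>real_of_int k\<bar>) powr - a) (range (\<lambda>n. - int n))"
    using s by (subst abs_summable_on_reindex_iff[symmetric]) (auto simp: inj_on_def)
  ultimately have "Infinite_Set_Sum.abs_summable_on (\<lambda>k::int. (1 + \<bar>real_of_int k\<bar>) powr - a) (range int \<union> range (\<lambda>n. - int n))"
    by (rule abs_summable_on_union)
  moreover have "range int \<union> range (\<lambda>n. - int n) = UNIV"
    by (auto simp: image_iff) (metis int_cases2)
  ultimately show ?thesis by simp
qed

lemma nn_integral_abs_summable:
  fixes f :: "'a \<Rightarrow> real"
  assumes "Infinite_Set_Sum.abs_summable_on f S" "\<And>x. x \<in> S \<Longrightarrow> 0 \<le> f x"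
  shows "(\<integral>\<^sup>+x. ennreal (f x) \<partial>count_space S) < \<infinity>"
proof -
  have "(\<integral>\<^sup>+x. ennreal (f x) \<partial>count_space S) = (\<integral>\<^sup>+x. ennreal (norm (f x)) \<partial>count_space S)"
    using assms(2) by (intro nn_integral_cong) auto
  also have "\<dots> < \<infinity>"
    using assms(1) by (simp add: abs_summable_on_def integrable_iff_bounded)
  finally show ?thesis .
qed

text \<open>The integers \<open>\<lfloor>L x / \<delta>\<rfloor>\<close> are distinct, so the sum is dominated by one over the integers; the
  factor \<open>(X / \<delta>) powr (2 - 2 * s)\<close> is the price of replacing the divergent exponent \<open>s\<close> by \<open>2 - s > 1\<close>.\<close>

lemma nn_integral_sing_separated:
  fixes L :: "'a \<Rightarrow> real"
  assumes s: "0 < s" "s < 1" and "\<delta> > 0" "\<delta> \<le> X"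
    and sep: "\<And>x y. x \<in> S \<Longrightarrow> y \<in> S \<Longrightarrow> x \<noteq> y \<Longrightarrow> \<delta> \<le> \<bar>L x - L y\<bar>"
    and lower: "\<And>x. x \<in> S \<Longrightarrow> \<delta> \<le> \<bar>L x\<bar>"
    and upper: "\<And>x. x \<in> S \<Longrightarrow> \<bar>L x\<bar> \<le> X"
  shows "(\<integral>\<^sup>+x. sing s (L x) \<partial>count_space S)
     \<le> ennreal (9 * \<delta> powr - s * (X / \<delta>) powr (2 - 2 * s))
         * (\<integral>\<^sup>+k. ennreal ((1 + \<bar>real_of_int k\<bar>) powr - (2 - s)) \<partial>count_space UNIV)"
proof -
  define f where "f x = \<lfloor>L x / \<delta>\<rfloor>" for x
  have "inj_on f S"
  proof (rule inj_onI, rule ccontr)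
    fix x y assume xy: "x \<in> S" "y \<in> S" "f x = f y" "x \<noteq> y"
    have "\<bar>L x / \<delta> - L y / \<delta>\<bar> < 1" using xy(3) unfolding f_def by linarith
    then have "\<bar>L x - L y\<bar> < \<delta>"
      using \<open>\<delta> > 0\<close> by (simp add: diff_divide_distrib[symmetric] abs_divide)
    then show False using sep[OF xy(1,2,4)] by linarith
  qed
  then have "(\<integral>\<^sup>+x. sing s (L x) \<partial>count_space S)
     \<le> (\<integral>\<^sup>+k. ennreal (9 * \<delta> powr - s * (X / \<delta>) powr (2 - 2 * s)) * ennreal ((1 + \<bar>real_of_int k\<bar>) powr - (2 - s)) \<partial>count_space UNIV)"
  proof (rule nn_integral_count_space_le_injection)
    fix x assume x: "x \<in> S"
    define y where "y = \<bar>L x\<bar> / \<delta>"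
    have y: "y \<ge> 1" "y \<le> X / \<delta>"
      using lower[OF x] upper[OF x] \<open>\<delta> > 0\<close> by (auto simp: y_def divide_right_mono)
    \<comment> \<open>Rounding costs at most 1, which \<open>y \<ge> 1\<close> absorbs into the
      factor 3; raised to the power \<open>2 - s\<close> this factor gives the constant 9.\<close>
    have "1 + \<bar>real_of_int (f x)\<bar> \<le> \<bar>L x / \<delta>\<bar> + 2" unfolding f_def by linarith
    also have "\<bar>L x / \<delta>\<bar> = y" using \<open>\<delta> > 0\<close> by (simp add: y_def abs_divide)
    finally have u: "1 + \<bar>real_of_int (f x)\<bar> \<le> 3 * y" using y by linarith
    define u where "u = 1 + \<bar>real_of_int (f x)\<bar>"
    have "y powr - s = y powr (2 - 2 * s) * y powr - (2 - s)"
      by (simp flip: powr_add)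
    also have "\<dots> \<le> (X / \<delta>) powr (2 - 2 * s) * (u / 3) powr - (2 - s)"
      using y u s by (intro mult_mono powr_mono2 powr_mono2') (auto simp: u_def)
    also have "(u / 3) powr - (2 - s) = 3 powr (2 - s) * u powr - (2 - s)"
      by (subst (1 2) powr_minus) (simp add: powr_divide u_def field_simps)
    also have "(X / \<delta>) powr (2 - 2 * s) * (3 powr (2 - s) * u powr - (2 - s))
        \<le> (X / \<delta>) powr (2 - 2 * s) * (3 powr 2 * u powr - (2 - s))"
      using s by (intro mult_left_mono mult_right_mono powr_mono) auto
    finally have *: "y powr - s \<le> 9 * (X / \<delta>) powr (2 - 2 * s) * u powr - (2 - s)"
      by (simp add: mult_ac)
    have "L x \<noteq> 0" using lower[OF x] \<open>\<delta> > 0\<close> by auto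
    then have "sing s (L x) = ennreal (\<delta> powr - s * y powr - s)"
      using \<open>\<delta> > 0\<close> by (simp add: sing_nonzero y_def powr_mult[symmetric])
    also have "\<dots> \<le> ennreal (\<delta> powr - s * (9 * (X / \<delta>) powr (2 - 2 * s) * u powr - (2 - s)))"
      using * by (intro ennreal_leI mult_left_mono) auto
    also have "\<dots> = ennreal (9 * \<delta> powr - s * (X / \<delta>) powr (2 - 2 * s)) * ennreal (u powr - (2 - s))"
      by (subst ennreal_mult[symmetric]) (auto simp: mult_ac)
    finally show "sing s (L x) \<le> ennreal (9 * \<delta> powr - s * (X / \<delta>) powr (2 - 2 * s)) * ennreal ((1 + \<bar>real_of_int (f x)\<bar>) powr - (2 - s))"
      by (simp add: u_def)
  qed auto
  then show ?thesis by (simp add: nn_integral_cmult)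
qed

lemma infnorm_le_bound_inner:
  "\<bar>b \<bullet> z\<bar> \<le> (\<Sum>i\<in>UNIV. \<bar>b $ i\<bar>) * infnorm (z :: real^'n)"
proof -
  have "\<bar>b \<bullet> z\<bar> \<le> (\<Sum>i\<in>UNIV. \<bar>b $ i * z $ i\<bar>)"
    unfolding inner_vec_def inner_real_def by (rule sum_abs)
  also have "\<dots> \<le> (\<Sum>i\<in>UNIV. \<bar>b $ i\<bar> * infnorm z)"
    by (intro sum_mono) (auto simp: abs_mult intro!: mult_left_mono component_le_infnorm_cart)
  finally show ?thesis by (simp add: sum_distrib_right)
qed

text \<open>The points are split into dyadic shells. Differences stay in \<open>H\<close>, so
  \<open>lower\<close> separates the values of the form on a shell and
  \<open>nn_integral_sing_separated\<close> applies. A shell of norm about \<open>N\<close>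
  contributes at most a constant times \<open>N powr e\<close>, and the assumption on
  \<open>a\<close> says that \<open>e\<close> is negative, so the shells are dominated by a
  geometric series.\<close>

lemma nn_integral_sing_subgroup:
  fixes H :: "(real^'n) set"
  assumes s: "0 < s" "s < 1" and c: "c > 0" and t: "t \<ge> 0"
    and diff: "\<And>x y. x \<in> H \<Longrightarrow> y \<in> H \<Longrightarrow> x - y \<in> H"
    and ge1: "\<And>x. x \<in> H \<Longrightarrow> x \<noteq> 0 \<Longrightarrow> 1 \<le> infnorm x"
    and lower: "\<And>x. x \<in> H \<Longrightarrow> x \<noteq> 0 \<Longrightarrow> c * infnorm x powr - t \<le> \<bar>b \<bullet> x\<bar>"
    and a: "a > s * t + 2 * (1 - s) * (t + 1)"
  shows "(\<integral>\<^sup>+z. ennreal (infnorm z powr - a) * sing s (b \<bullet> z) \<partial>count_space (H - {0})) < \<infinity>"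
proof -
  define S where "S k = {x \<in> H. 2 ^ k \<le> infnorm x \<and> infnorm x < 2 ^ Suc k}" for k :: nat
  define F where "F z = ennreal (infnorm z powr - a) * sing s (b \<bullet> z)" for z
  define D where "D = (\<integral>\<^sup>+k. ennreal ((1 + \<bar>real_of_int k\<bar>) powr - (2 - s)) \<partial>count_space UNIV)"
  have Dfin: "D < \<infinity>"
    unfolding D_def using s by (intro nn_integral_abs_summable abs_summable_int_powr) auto
  \<comment> \<open>The sum bounds the form; the added \<open>c\<close> ensures \<delta> \<le> X on
    every shell.\<close>
  define K where "K = (\<Sum>i\<in>UNIV. \<bar>b $ i\<bar>) + c"
  have K: "K \<ge> c" "K > 0" unfolding K_def using c by (auto intro: sum_nonneg add_nonneg_pos)
  define N :: "nat \<Rightarrow> real" where "N k = 2 powr k" for k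
  define e where "e = - a + s * t + 2 * (1 - s) * (t + 1)"
  have e: "e < 0" using a by (simp add: e_def)
  define C where "C = 9 * (c * 4 powr - t) powr - s * (2 * K / (c * 4 powr - t)) powr (2 - 2 * s)"
  have shell: "(\<integral>\<^sup>+z. F z \<partial>count_space (S k)) \<le> ennreal (C * (2 powr e) ^ k) * D" for k
  proof -
    \<comment> \<open>Points of the shell have norm below \<open>2 * N k\<close>, hence their
      differences have norm below \<open>4 * N k\<close>.\<close>
    define \<delta> where "\<delta> = c * (4 * N k) powr - t"
    define X where "X = 2 * K * N k"
    have N: "N k \<ge> 1" "2 ^ k = N k" by (auto simp: N_def powr_realpow ge_one_powr_ge_zero)
    have \<delta>: "\<delta> > 0" using c N by (simp add: \<delta>_def)
    have low: "\<delta> \<le> \<bar>b \<bullet> x\<bar>" if "x \<in> H" "x \<noteq> 0" "infnorm x < 4 * N k" for x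
    proof -
      have "\<delta> \<le> c * infnorm x powr - t"
        unfolding \<delta>_def using c t that ge1[OF that(1,2)] by (intro mult_left_mono powr_mono2') auto
      then show ?thesis using lower[OF that(1,2)] by linarith
    qed
    have "(\<integral>\<^sup>+z. F z \<partial>count_space (S k)) \<le> (\<integral>\<^sup>+z. ennreal (N k powr - a) * sing s (b \<bullet> z) \<partial>count_space (S k))"
    proof (intro nn_integral_mono)
      fix z assume "z \<in> space (count_space (S k))"
      then have z: "N k \<le> infnorm z" by (simp add: S_def N)
      have "a \<ge> 0" using a s t by (smt (verit) mult_nonneg_nonneg)
      then have "infnorm z powr - a \<le> N k powr - a"
        using z N by (intro powr_mono2') auto
      then show "F z \<le> ennreal (N k powr - a) * sing s (b \<bullet> z)"
        unfolding F_def by (intro mult_right_mono ennreal_leI) auto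
    qed
    also have "\<dots> = ennreal (N k powr - a) * (\<integral>\<^sup>+z. sing s (b \<bullet> z) \<partial>count_space (S k))"
      by (simp add: nn_integral_cmult)
    also have "(\<integral>\<^sup>+z. sing s (b \<bullet> z) \<partial>count_space (S k))
       \<le> ennreal (9 * \<delta> powr - s * (X / \<delta>) powr (2 - 2 * s)) * D"
      unfolding D_def
    proof (rule nn_integral_sing_separated[OF s \<delta>])
      fix x y assume xy: "x \<in> S k" "y \<in> S k" "x \<noteq> y"
      have "infnorm (x - y) \<le> infnorm x + infnorm y"
        using infnorm_triangle[of x "- y"] by (simp add: infnorm_neg)
      also have "\<dots> < 4 * N k" using xy N by (simp add: S_def)
      finally have "\<delta> \<le> \<bar>b \<bullet> (x - y)\<bar>" using xy diff by (intro low) (auto simp: S_def)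
      then show "\<delta> \<le> \<bar>b \<bullet> x - b \<bullet> y\<bar>" by (simp add: inner_diff_right)
    next
      fix x assume x: "x \<in> S k"
      have x': "x \<in> H" "N k \<le> infnorm x" "infnorm x < 2 * N k" using x N by (auto simp: S_def)
      have "x \<noteq> 0" using x'(2) N by (auto simp: infnorm_0)
      then show "\<delta> \<le> \<bar>b \<bullet> x\<bar>" using x' N by (intro low) auto
      have "\<bar>b \<bullet> x\<bar> \<le> (\<Sum>i\<in>UNIV. \<bar>b $ i\<bar>) * infnorm x" by (rule infnorm_le_bound_inner)
      also have "\<dots> \<le> K * (2 * N k)"
        using x' c K by (intro mult_mono) (auto simp: K_def infnorm_pos_le)
      finally show "\<bar>b \<bullet> x\<bar> \<le> X" by (simp add: X_def mult_ac)
    next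
      have "\<delta> \<le> c * 1" unfolding \<delta>_def using c N t powr_mono[of "-t" 0 "4 * N k"]
        by (intro mult_left_mono) auto
      also have "c * 1 \<le> X" unfolding X_def using K N c mult_mono[of c "2 * K" 1 "N k"] by simp
      finally show "\<delta> \<le> X" .
    qed
    also have "ennreal (N k powr - a) * (ennreal (9 * \<delta> powr - s * (X / \<delta>) powr (2 - 2 * s)) * D)
      = ennreal (N k powr - a * (9 * \<delta> powr - s * (X / \<delta>) powr (2 - 2 * s))) * D"
      by (subst ennreal_mult) (auto simp: mult_ac)
    \<comment> \<open>Up to constants \<delta> is \<open>N k powr - t\<close> and
      \<open>X / \<delta>\<close> is \<open>N k powr (t + 1)\<close>, so the exponents add up to
      \<open>e\<close>.\<close>
    also have "N k powr - a * (9 * \<delta> powr - s * (X / \<delta>) powr (2 - 2 * s)) = C * N k powr e"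
    proof -
      have \<delta>': "\<delta> = (c * 4 powr - t) * N k powr - t" unfolding \<delta>_def using N by (simp add: powr_mult)
      have X': "X / \<delta> = (2 * K / (c * 4 powr - t)) * N k powr (t + 1)"
        unfolding \<delta>' X_def using N c by (simp add: powr_add powr_minus field_simps)
      have 1: "\<delta> powr - s = (c * 4 powr - t) powr - s * N k powr (s * t)"
        unfolding \<delta>' using c by (simp add: powr_mult powr_powr mult_ac)
      have 2: "(X / \<delta>) powr (2 - 2 * s) = (2 * K / (c * 4 powr - t)) powr (2 - 2 * s) * N k powr (2 * (1 - s) * (t + 1))"
        unfolding X' by (subst powr_mult) (use c K in \<open>auto simp: powr_powr algebra_simps\<close>)
      have 3: "N k powr e = N k powr - a * (N k powr (s * t) * N k powr (2 * (1 - s) * (t + 1)))"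
        unfolding e_def by (simp only: powr_add mult.assoc)
      show ?thesis unfolding 1 2 3 C_def by (simp add: mult_ac)
    qed
    also have "N k powr e = (2 powr e) ^ k"
      unfolding N_def by (simp add: powr_powr powr_realpow[symmetric] mult.commute)
    finally show ?thesis by (simp add: mult_left_mono)
  qed
  have "(\<integral>\<^sup>+z. F z \<partial>count_space (H - {0}))
      \<le> (\<integral>\<^sup>+z. (\<Sum>k. F z * indicator (S k) z) \<partial>count_space (H - {0}))"
  proof (intro nn_integral_mono)
    fix z assume "z \<in> space (count_space (H - {0}))"
    then have z: "z \<in> H" "1 \<le> infnorm z" using ge1 by auto
    define k where "k = nat \<lfloor>log 2 (infnorm z)\<rfloor>"
    have l: "0 \<le> log 2 (infnorm z)" using z by simp
    have "real k \<le> log 2 (infnorm z)" "log 2 (infnorm z) < real (k + 1)"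
      using l unfolding k_def by linarith+
    then have "2 powr k \<le> infnorm z" "infnorm z < 2 powr (k + 1)"
      using z by (simp_all only: le_log_iff log_less_iff)
    then have "z \<in> S k" using z by (simp add: S_def powr_realpow powr_add)
    then have "F z = F z * indicator (S k) z" by simp
    also have "\<dots> \<le> (\<Sum>k. F z * indicator (S k) z)"
      by (rule ennreal_le_suminf)
    finally show "F z \<le> (\<Sum>k. F z * indicator (S k) z)" .
  qed
  also have "\<dots> = (\<Sum>k. \<integral>\<^sup>+z. F z * indicator (S k) z \<partial>count_space (H - {0}))"
    by (intro nn_integral_suminf) auto
  also have "\<dots> \<le> (\<Sum>k. ennreal (C * (2 powr e) ^ k) * D)"
  proof (intro suminf_le)
    fix k
    have "S k \<subseteq> H - {0}"
    proof
      fix z assume z: "z \<in> S k"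
      have "(0::real) < 2 ^ k" by simp
      also have "\<dots> \<le> infnorm z" using z by (simp add: S_def)
      finally have "z \<noteq> 0" by (auto simp: infnorm_0)
      then show "z \<in> H - {0}" using z by (simp add: S_def)
    qed
    then have "(\<integral>\<^sup>+z. F z * indicator (S k) z \<partial>count_space (H - {0})) = (\<integral>\<^sup>+z. F z \<partial>count_space (S k))"
      by (rule nn_integral_count_space_restrict)
    then show "(\<integral>\<^sup>+z. F z * indicator (S k) z \<partial>count_space (H - {0})) \<le> ennreal (C * (2 powr e) ^ k) * D"
      using shell[of k] by simp
  qed auto
  also have "\<dots> = (\<Sum>k. ennreal (C * (2 powr e) ^ k)) * D"
    by (rule ennreal_suminf_multc)
  also have "(\<Sum>k. ennreal (C * (2 powr e) ^ k)) = ennreal (\<Sum>k. C * (2 powr e) ^ k)"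
  proof (rule suminf_ennreal2)
    have "2 powr e < 2 powr 0" using e by (intro powr_less_mono) auto
    then show "summable (\<lambda>k. C * (2 powr e) ^ k)"
      by (intro summable_mult summable_geometric) (simp del: powr_less_cancel_iff)
  qed (simp add: C_def)
  also have "\<dots> * D < \<infinity>" using Dfin by (simp add: ennreal_mult_less_top)
  finally show ?thesis unfolding F_def .
qed

section \<open>Choosing the linear forms\<close>

lemma obtain_distinct:
  assumes "CARD('n::finite) \<ge> 2"
  obtains i j :: "'n::finite" where "i \<noteq> j"
proof -
  have "\<not> CARD('n) \<le> 1" using assms by linarith
  then show thesis using that card_le_Suc0_iff_eq[of "UNIV :: 'n set"] by auto
qed

lemma nn_integral_count_space_Un_le:
  assumes "C \<subseteq> A \<union> B"
  shows "(\<integral>\<^sup>+x. f x \<partial>count_space C) \<le> (\<integral>\<^sup>+x. f x \<partial>count_space A) + (\<integral>\<^sup>+x. f x \<partial>count_space B)"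
proof -
  have "(\<integral>\<^sup>+x. f x \<partial>count_space C) = (\<integral>\<^sup>+x. f x * indicator C x \<partial>count_space UNIV)"
    by (rule nn_integral_count_space_restrict[OF subset_UNIV, symmetric])
  also have "\<dots> \<le> (\<integral>\<^sup>+x. f x * indicator A x + f x * indicator B x \<partial>count_space UNIV)"
    using assms by (intro nn_integral_mono) (auto simp: indicator_def)
  also have "\<dots> = (\<integral>\<^sup>+x. f x * indicator A x \<partial>count_space UNIV) + (\<integral>\<^sup>+x. f x * indicator B x \<partial>count_space UNIV)"
    by (intro nn_integral_add) auto
  also have "\<dots> = (\<integral>\<^sup>+x. f x \<partial>count_space A) + (\<integral>\<^sup>+x. f x \<partial>count_space B)"
    by (simp only: nn_integral_count_space_restrict[OF subset_UNIV])
  finally show ?thesis .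
qed

section \<open>Series over integer vectors\<close>

definition int_vecs :: "(real^'n) set" where
  "int_vecs = {x. \<forall>i. x $ i \<in> \<int>}"

lemma bij_betw_int_vecs:
  "bij_betw (\<lambda>g. \<chi> i. real_of_int (g i)) (UNIV :: ('n::finite \<Rightarrow> int) set) int_vecs"
proof (rule bij_betwI[where g = "\<lambda>x i. \<lfloor>x $ i\<rfloor>"])
qed (auto simp: int_vecs_def vec_eq_iff)

lemma countable_int_vecs: "countable (int_vecs :: (real^'n) set)"
  using bij_betw_int_vecs[where 'n='n]
  by (metis bij_betw_imp_surj_on countableI_type countable_image)

lemma int_vecs_infnorm_ge_1:
  assumes "x \<in> int_vecs" "x \<noteq> 0"
  shows "1 \<le> infnorm x"
proof -
  obtain i where "x $ i \<noteq> 0" using assms(2) by (auto simp: vec_eq_iff)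
  then have "1 \<le> \<bar>x $ i\<bar>" using assms(1) by (auto simp: int_vecs_def Ints_nonzero_abs_ge1)
  then show ?thesis using component_le_infnorm_cart[of x i] by linarith
qed

lemma int_vecs_diff: "x \<in> int_vecs \<Longrightarrow> y \<in> int_vecs \<Longrightarrow> x - y \<in> int_vecs"
  by (auto simp: int_vecs_def)

text \<open>The series factors into one-dimensional ones. It is the majorant in
  \<open>nn_integral_int_vecs_split\<close>.\<close>

lemma nn_integral_int_vecs_prod:
  assumes "a > 1"
  shows "(\<integral>\<^sup>+z. ennreal (\<Prod>j\<in>UNIV. (1 + \<bar>z $ j\<bar>) powr - a) \<partial>count_space (int_vecs :: (real^'n) set)) < \<infinity>"
proof -
  have "Infinite_Set_Sum.abs_summable_on
     (\<lambda>g::'n \<Rightarrow> int. \<Prod>j\<in>UNIV. (1 + \<bar>real_of_int (g j)\<bar>) powr - a) (PiE UNIV (\<lambda>_. UNIV))"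
    using assms by (intro abs_summable_on_prod_PiE abs_summable_int_powr) auto
  then have "(\<integral>\<^sup>+g. ennreal (\<Prod>j\<in>UNIV. (1 + \<bar>real_of_int (g j)\<bar>) powr - a) \<partial>count_space (UNIV :: ('n \<Rightarrow> int) set)) < \<infinity>"
    by (intro nn_integral_abs_summable) (auto simp: PiE_UNIV_domain intro!: prod_nonneg)
  then show ?thesis
    by (subst nn_integral_bij_count_space[OF bij_betw_int_vecs, symmetric]) simp
qed

lemma infnorm_le_iff: "infnorm (x :: real^'n) \<le> a \<longleftrightarrow> (\<forall>i. \<bar>x $ i\<bar> \<le> a)"
  by (subst infnorm_eq_Max) (subst Max_le_iff, auto)

text \<open>The term is compared with the product of all
  \<open>(1 + \<bar>z $ j\<bar>) powr - a\<close>, where \<open>a\<close> is slightly above 1: the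
  coordinates at \<open>i0\<close> and \<open>i1\<close> are bounded by \<open>infnorm z\<close>,
  the other \<open>n - 2\<close> by \<open>infnorm (P z)\<close>. The comparison rests on
  \<open>A \<ge> 2 * a\<close> and \<open>A + s \<ge> n * a\<close>.\<close>

lemma nn_integral_int_vecs_split:
  fixes i0 i1 :: "'n::finite" and P :: "real^'n \<Rightarrow> real^'n"
  assumes "i0 \<noteq> i1" and n3: "CARD('n) \<ge> 3" and \<epsilon>: "0 < \<epsilon>" "\<epsilon> < 1"
    and A: "A \<ge> real CARD('n) - 1 + \<epsilon>" and s: "s \<ge> 1 - \<epsilon> / 2"
  defines "P \<equiv> \<lambda>z. \<chi> j. if j = i0 \<or> j = i1 then 0 else z $ j"
  shows "(\<integral>\<^sup>+z. ennreal (infnorm z powr - A) * sing s (infnorm (P z))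
            \<partial>count_space {z \<in> int_vecs. P z \<noteq> 0}) < \<infinity>"
proof -
  define n where "n = CARD('n)"
  \<comment> \<open>Then \<open>n * a = n + \<epsilon> / 2\<close>, the lower bound that the
    assumptions give for \<open>A + s\<close>.\<close>
  define \<eta> where "\<eta> = \<epsilon> / (2 * n)"
  define a where "a = 1 + \<eta>"
  have n: "real n \<ge> 3" using n3 by (simp add: n_def)
  have \<eta>: "\<eta> > 0" "n * \<eta> = \<epsilon> / 2" using \<epsilon> n by (auto simp: \<eta>_def)
  have "2 * \<eta> \<le> n * \<eta>" using n \<eta>(1) by (intro mult_right_mono) auto
  then have A2: "A \<ge> 2 * a" using A n \<eta> \<epsilon> by (simp add: a_def n_def[symmetric])
  have As: "A + s \<ge> n * a" using A s \<eta> by (simp add: a_def n_def[symmetric] algebra_simps)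
  have pt: "infnorm z powr - A * infnorm (P z) powr - s
      \<le> 2 powr (n * a) * (\<Prod>j\<in>UNIV. (1 + \<bar>z $ j\<bar>) powr - a)"
    if z: "z \<in> int_vecs" "P z \<noteq> 0" for z
  proof -
    define N M where "N = infnorm z" and "M = infnorm (P z)"
    have "P 0 = 0" by (simp add: P_def vec_eq_iff)
    then have "z \<noteq> 0" using z(2) by auto
    then have N1: "N \<ge> 1" unfolding N_def using z int_vecs_infnorm_ge_1 by auto
    have "P z \<in> int_vecs" using z(1) by (auto simp: int_vecs_def P_def)
    then have M1: "M \<ge> 1" unfolding M_def using z(2) int_vecs_infnorm_ge_1 by auto
    have zN: "\<bar>z $ j\<bar> \<le> N" for j unfolding N_def by (rule component_le_infnorm_cart)
    have MN: "M \<le> N" unfolding M_def infnorm_le_iff using zN N1 by (auto simp: P_def)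
    have zM: "\<bar>z $ j\<bar> \<le> M" if "j \<noteq> i0" "j \<noteq> i1" for j
      using component_le_infnorm_cart[of "P z" j] that by (simp add: P_def M_def)
    define X where "X j = (if j \<in> {i0, i1} then N else M)" for j
    have "(\<Prod>j\<in>UNIV. X j powr - a) = (\<Prod>j\<in>UNIV - {i0,i1}. M powr - a) * (\<Prod>j\<in>{i0,i1}. N powr - a)"
      by (subst prod.subset_diff[of "{i0, i1}"]) (auto simp: X_def intro!: prod.cong)
    also have "\<dots> = M powr (- a * (n - 2)) * N powr (- a * 2)"
    proof -
      have "card (UNIV - {i0, i1}) = n - 2" using \<open>i0 \<noteq> i1\<close> by (subst card_Diff_subset) (auto simp: n_def)
      moreover have "(M powr - a) ^ (n - 2) = M powr (- a * (n - 2))"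
        using M1 by (subst powr_power) (auto simp: mult_ac)
      moreover have "N powr - a * N powr - a = N powr (- a * 2)"
        by (simp flip: powr_add) (simp add: mult.commute)
      ultimately show ?thesis using \<open>i0 \<noteq> i1\<close> by (simp del: mult_minus_left)
    qed
    finally have prodX: "(\<Prod>j\<in>UNIV. X j powr - a) = M powr (- a * (n - 2)) * N powr (- a * 2)" .
    \<comment> \<open>Since \<open>M \<le> N\<close>, the surplus exponent \<open>A - 2 * a\<close>
      may be transferred from \<open>N\<close> to \<open>M\<close>.\<close>
    have "N powr - A = N powr (- a * 2) * N powr - (A - 2 * a)"
      by (simp flip: powr_add)
    also have "\<dots> \<le> N powr (- a * 2) * M powr - (A - 2 * a)"
      using A2 MN M1 by (intro mult_left_mono powr_mono2') auto
    finally have "N powr - A * M powr - s \<le> N powr (- a * 2) * M powr - (A - 2 * a) * M powr - s"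
      by (intro mult_right_mono) auto
    also have "\<dots> = N powr (- a * 2) * M powr (- (A - 2 * a) - s)"
      by (simp add: powr_diff powr_minus divide_inverse mult.assoc)
    also have "\<dots> \<le> N powr (- a * 2) * M powr (- a * (n - 2))"
      using M1 As n by (intro mult_left_mono powr_mono) (auto simp: algebra_simps of_nat_diff)
    also have "\<dots> = (\<Prod>j\<in>UNIV. X j powr - a)" by (simp add: prodX mult.commute)
    also have "\<dots> \<le> (\<Prod>j\<in>UNIV. 2 powr a * (1 + \<bar>z $ j\<bar>) powr - a)"
    proof (intro prod_mono conjI)
      fix j
      have "1 + \<bar>z $ j\<bar> \<le> 2 * X j"
        using zN[of j] zM[of j] N1 M1 by (auto simp: X_def)
      then have "(2 * X j) powr - a \<le> (1 + \<bar>z $ j\<bar>) powr - a"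
        using \<eta> by (intro powr_mono2') (auto simp: a_def)
      then have "2 powr a * (2 * X j) powr - a \<le> 2 powr a * (1 + \<bar>z $ j\<bar>) powr - a"
        by (intro mult_left_mono) auto
      moreover have "2 powr a * (2 * X j) powr - a = X j powr - a"
        using N1 M1 by (simp add: X_def powr_mult powr_minus)
      ultimately show "X j powr - a \<le> 2 powr a * (1 + \<bar>z $ j\<bar>) powr - a" by simp
    qed auto
    also have "\<dots> = 2 powr (n * a) * (\<Prod>j\<in>UNIV. (1 + \<bar>z $ j\<bar>) powr - a)"
      by (simp add: prod.distrib powr_power n_def mult.commute)
    finally show ?thesis by (simp add: N_def M_def)
  qed
  define Z where "Z = {z \<in> int_vecs. P z \<noteq> 0}"
  have "(\<integral>\<^sup>+z. ennreal (infnorm z powr - A) * sing s (infnorm (P z)) \<partial>count_space Z)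
     \<le> (\<integral>\<^sup>+z. ennreal (2 powr (n * a)) * ennreal (\<Prod>j\<in>UNIV. (1 + \<bar>z $ j\<bar>) powr - a) \<partial>count_space Z)"
  proof (intro nn_integral_mono)
    fix z assume "z \<in> space (count_space Z)"
    then have z: "z \<in> int_vecs" "P z \<noteq> 0" by (auto simp: Z_def)
    have "ennreal (infnorm z powr - A) * sing s (infnorm (P z))
       = ennreal (infnorm z powr - A * infnorm (P z) powr - s)"
      using z(2) by (simp add: sing_nonzero infnorm_eq_0 infnorm_pos_le ennreal_mult)
    also have "\<dots> \<le> ennreal (2 powr (n * a) * (\<Prod>j\<in>UNIV. (1 + \<bar>z $ j\<bar>) powr - a))"
      using pt[OF z] by (intro ennreal_leI)
    also have "\<dots> = ennreal (2 powr (n * a)) * ennreal (\<Prod>j\<in>UNIV. (1 + \<bar>z $ j\<bar>) powr - a)"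
      by (intro ennreal_mult prod_nonneg) auto
    finally show "ennreal (infnorm z powr - A) * sing s (infnorm (P z)) \<le> \<dots>" .
  qed
  also have "\<dots> \<le> (\<integral>\<^sup>+z. ennreal (2 powr (n * a)) * ennreal (\<Prod>j\<in>UNIV. (1 + \<bar>z $ j\<bar>) powr - a) \<partial>count_space (int_vecs :: (real^'n) set))"
    by (rule order.trans[OF nn_integral_count_space_Un_le[of Z int_vecs "{}"]])
       (auto simp: Z_def nn_integral_count_space_finite)
  also have "\<dots> = ennreal (2 powr (n * a)) * (\<integral>\<^sup>+z. ennreal (\<Prod>j\<in>UNIV. (1 + \<bar>z $ j\<bar>) powr - a) \<partial>count_space (int_vecs::(real^'n) set))"
    by (intro nn_integral_cmult) auto
  also have "\<dots> < \<infinity>"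
    using nn_integral_int_vecs_prod[of a, where 'n='n] \<eta> by (simp add: a_def ennreal_mult_less_top)
  finally show ?thesis by (simp add: Z_def)
qed

lemma AE_cube_obtain:
  assumes "AE f in (cube :: ('n::finite \<Rightarrow> real) measure). Q f"
  obtains f where "Q f"
proof -
  have "\<exists>f. Q f"
  proof (rule ccontr)
    assume nQ: "\<not> (\<exists>f. Q f)"
    from assms have "AE f in (cube :: ('n \<Rightarrow> real) measure). False"
      by eventually_elim (use nQ in blast)
    then show False
      by (subst (asm) prob_space.AE_False[OF prob_space_PiM[OF prob_space_unif]])
  qed
  then show thesis using that by blast
qed

text \<open>Points with a nonzero coordinate outside \<open>{i0, i1}\<close> are controlled by the random
  coefficients, the others by the separation argument, as \<open>\<alpha>\<close> has order exactly \<open>\<tau>\<close>.\<close>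

lemma exists_first_row:
  fixes \<tau> :: real and A s :: "nat \<Rightarrow> real"
  assumes n3: "CARD('n::finite) \<ge> 3" and \<tau>: "\<tau> \<ge> real CARD('n) - 1"
  defines "A \<equiv> \<lambda>m. \<tau> + 1 / (m + 2)" and "s \<equiv> \<lambda>m. 1 - 1 / ((m + 2) * (\<tau> + 3))"
  obtains b :: "real^'n" where "b \<noteq> 0"
    "\<And>m. (\<integral>\<^sup>+z. ennreal (infnorm z powr - A m) * sing (s m) (b \<bullet> z) \<partial>count_space (int_vecs - {0})) < \<infinity>"
    "\<And>N::nat. \<exists>z\<in>int_vecs. infnorm z > N \<and> \<bar>b \<bullet> z\<bar> \<le> 4 * infnorm z powr - \<tau>"
proof -
  have \<tau>2: "\<tau> \<ge> 2" using n3 \<tau> by linarith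
  obtain i0 i1 :: 'n where i01: "i0 \<noteq> i1"
    by (rule obtain_distinct[where 'n='n]) (use n3 in linarith)
  obtain \<alpha> c :: real where c: "c > 0"
    and low: "\<And>p q :: int. (p, q) \<noteq> (0, 0) \<Longrightarrow> c * real_of_int (max \<bar>p\<bar> \<bar>q\<bar>) powr - \<tau> \<le> \<bar>p - \<alpha> * q\<bar>"
    and infm: "\<And>N::nat. \<exists>p q :: int. q > int N \<and> \<bar>p\<bar> \<le> q \<and> \<bar>p - \<alpha> * q\<bar> \<le> 4 * real_of_int q powr - \<tau>"
    using exists_exactly_approximable[OF \<tau>2] by metis
  define P :: "real^'n \<Rightarrow> real^'n" where "P = (\<lambda>z. \<chi> j. if j = i0 \<or> j = i1 then 0 else z $ j)"
  define row :: "('n \<Rightarrow> real) \<Rightarrow> real^'n"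
    where "row f = (\<chi> j. if j = i0 then 1 else if j = i1 then - \<alpha> else f j)" for f
  have row: "row f \<bullet> z = vec_lambda f \<bullet> P z + (z $ i0 - \<alpha> * z $ i1)" for f z
  proof -
    have "row f \<bullet> z = (\<Sum>j\<in>UNIV. f j * P z $ j + ((if j = i0 then z $ j else 0) + (if j = i1 then - \<alpha> * z $ j else 0)))"
      unfolding inner_vec_def row_def P_def using i01 by (intro sum.cong) auto
    also have "\<dots> = vec_lambda f \<bullet> P z + (z $ i0 - \<alpha> * z $ i1)"
      by (simp add: sum.distrib inner_vec_def)
    finally show ?thesis .
  qed
  define Z where "Z = {z \<in> int_vecs. P z \<noteq> 0}"
  define H where "H = {z \<in> int_vecs. P z = 0}"
  define \<epsilon> where "\<epsilon> m = 1 / (real m + 2)" for m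
  have \<epsilon>: "0 < \<epsilon> m" "\<epsilon> m < 1" for m by (auto simp: \<epsilon>_def)
  have A: "A m = \<tau> + \<epsilon> m" and s: "s m = 1 - \<epsilon> m / (\<tau> + 3)" for m
    by (simp_all add: A_def s_def \<epsilon>_def)
  have s': "s m \<ge> 1 - \<epsilon> m / 2" "0 < s m" "s m < 1" for m
  proof -
    have "\<epsilon> m / (\<tau> + 3) \<le> \<epsilon> m / 2" using \<tau>2 \<epsilon>[of m] by (intro divide_left_mono) auto
    then show "s m \<ge> 1 - \<epsilon> m / 2" by (simp add: s)
    then show "0 < s m" using \<epsilon>[of m] by linarith
    show "s m < 1" using \<tau>2 \<epsilon>[of m] by (simp add: s)
  qed
  have cZ: "countable Z"
    by (rule countable_subset[OF _ countable_int_vecs]) (auto simp: Z_def)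
  \<comment> \<open>There are countably many \<open>m\<close>, so one \<open>f\<close> can serve all
    of them. The terms at \<open>i0\<close> and \<open>i1\<close> form the shift that is not
    random.\<close>
  have "AE f in cube. \<forall>m. (\<integral>\<^sup>+z. ennreal (infnorm z powr - A m) *
          sing (s m) (vec_lambda f \<bullet> P z + (z $ i0 - \<alpha> * z $ i1)) \<partial>count_space Z) < \<infinity>"
    unfolding AE_all_countable
  proof (intro allI AE_cube_sum_sing cZ s')
    fix m
    show "(\<integral>\<^sup>+z. ennreal (infnorm z powr - A m) * sing (s m) (infnorm (P z)) \<partial>count_space Z) < \<infinity>"
      unfolding Z_def P_def
      by (rule nn_integral_int_vecs_split[OF i01 n3 \<epsilon>[of m]]) (use \<tau> s'[of m] in \<open>auto simp: A\<close>)
  qed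
  then obtain f where f: "\<And>m. (\<integral>\<^sup>+z. ennreal (infnorm z powr - A m) *
          sing (s m) (row f \<bullet> z) \<partial>count_space Z) < \<infinity>"
    unfolding row[symmetric] by (rule AE_cube_obtain) blast
  have rowH: "row f \<bullet> z = z $ i0 - \<alpha> * z $ i1" if "P z = 0" for z
    using that by (simp add: row)
  have H: "(\<integral>\<^sup>+z. ennreal (infnorm z powr - A m) * sing (s m) (row f \<bullet> z) \<partial>count_space (H - {0})) < \<infinity>" for m
  proof (rule nn_integral_sing_subgroup[OF s'(2,3) c])
    show "x - y \<in> H" if "x \<in> H" "y \<in> H" for x y
      using that int_vecs_diff[of x y] by (auto simp: H_def P_def vec_eq_iff) metis
    show "1 \<le> infnorm x" if "x \<in> H" "x \<noteq> 0" for x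
      using that int_vecs_infnorm_ge_1 by (auto simp: H_def)
    show "c * infnorm x powr - \<tau> \<le> \<bar>row f \<bullet> x\<bar>" if x: "x \<in> H" "x \<noteq> 0" for x
    proof -
      obtain p q where pq: "x $ i0 = real_of_int p" "x $ i1 = real_of_int q"
        using x(1) by (auto simp: H_def int_vecs_def elim!: Ints_cases) (metis Ints_cases)
      have Px: "P x = 0" using x(1) by (simp add: H_def)
      have "(p, q) \<noteq> (0, 0)"
      proof
        assume "(p, q) = (0, 0)"
        then have "x = P x" using pq by (auto simp: P_def vec_eq_iff)
        then show False using Px x(2) by simp
      qed
      then have "c * real_of_int (max \<bar>p\<bar> \<bar>q\<bar>) powr - \<tau> \<le> \<bar>row f \<bullet> x\<bar>"
        using low[of p q] by (simp add: rowH[OF Px] pq)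
      moreover have "infnorm x powr - \<tau> \<le> real_of_int (max \<bar>p\<bar> \<bar>q\<bar>) powr - \<tau>"
        using component_le_infnorm_cart[of x i0] component_le_infnorm_cart[of x i1] pq \<tau>2
          \<open>(p, q) \<noteq> (0, 0)\<close>
        by (intro powr_mono2') (auto simp: max_def)
      ultimately show ?thesis using c by (smt (verit) mult_left_mono)
    qed
    \<comment> \<open>The left side is \<open>\<tau> + (1 - s m) * (\<tau> + 2)\<close>. The
      denominator \<tau> + 3 in \<open>s m\<close> is chosen to make the second summand smaller than
      \<open>\<epsilon> m\<close>.\<close>
    have "s m * \<tau> + 2 * (1 - s m) * (\<tau> + 1) = \<tau> + \<epsilon> m * ((\<tau> + 2) / (\<tau> + 3))"
    proof -
      have "s m * \<tau> + 2 * (1 - s m) * (\<tau> + 1) = \<tau> + (1 - s m) * (\<tau> + 2)"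
        by (simp add: algebra_simps)
      then show ?thesis by (simp add: s)
    qed
    also have "\<dots> < \<tau> + \<epsilon> m * 1" using \<tau>2 \<epsilon>[of m] by (intro add_strict_left_mono mult_strict_left_mono) auto
    finally show "s m * \<tau> + 2 * (1 - s m) * (\<tau> + 1) < A m" by (simp add: A)
  qed (use \<tau>2 in auto)
  show thesis
  proof (rule that[of "row f"])
    have "row f $ i0 = 1" by (simp add: row_def)
    then show "row f \<noteq> 0" by (metis zero_index zero_neq_one)
    fix m
    have "int_vecs - {0} \<subseteq> Z \<union> (H - {0})" by (auto simp: Z_def H_def)
    note nn_integral_count_space_Un_le[OF this, of "\<lambda>z. ennreal (infnorm z powr - A m) * sing (s m) (row f \<bullet> z)"]
    also have "(\<integral>\<^sup>+z. ennreal (infnorm z powr - A m) * sing (s m) (row f \<bullet> z) \<partial>count_space Z)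
        + (\<integral>\<^sup>+z. ennreal (infnorm z powr - A m) * sing (s m) (row f \<bullet> z) \<partial>count_space (H - {0})) < \<infinity>"
      using f[of m] H[of m] by simp
    finally show "(\<integral>\<^sup>+z. ennreal (infnorm z powr - A m) * sing (s m) (row f \<bullet> z) \<partial>count_space (int_vecs - {0})) < \<infinity>" .
  next
    fix N :: nat
    obtain p q :: int where pq: "q > int N" "\<bar>p\<bar> \<le> q" "\<bar>p - \<alpha> * q\<bar> \<le> 4 * real_of_int q powr - \<tau>"
      using infm[of N] by blast
    \<comment> \<open>Only the coordinates \<open>i0\<close> and \<open>i1\<close> are nonzero, so
      the random part vanishes, and \<open>\<bar>p\<bar> \<le> q\<close> makes \<open>q\<close> the
      maximum norm.\<close>
    define z :: "real^'n" where "z = (\<chi> j. if j = i0 then real_of_int p else if j = i1 then real_of_int q else 0)"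
    have "P z = 0" by (auto simp: P_def z_def vec_eq_iff)
    then have "row f \<bullet> z = p - \<alpha> * q" using i01 by (simp add: rowH) (simp add: z_def)
    moreover have "infnorm z = q"
    proof (rule antisym)
      show "infnorm z \<le> q" unfolding infnorm_le_iff using pq by (auto simp: z_def)
      show "q \<le> infnorm z" using component_le_infnorm_cart[of z i1] i01 pq by (simp add: z_def)
    qed
    ultimately show "\<exists>z\<in>int_vecs. infnorm z > N \<and> \<bar>row f \<bullet> z\<bar> \<le> 4 * infnorm z powr - \<tau>"
      using pq by (intro bexI[of _ z]) (auto simp: z_def int_vecs_def)
  qed
qed

text \<open>The inserted factor is normalised: with \<open>infnorm z\<close> in place of
  \<open>b \<bullet> z\<close> it equals 1, so the condition of \<open>AE_cube_sum_sing\<close> is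
  just convergence of the sum of \<open>W m\<close>. Avoiding \<open>span V\<close> and keeping all
  sums finite are both almost sure, so one random vector does both.\<close>

lemma exists_next_row:
  fixes V :: "(real^'n) set" and W :: "nat \<Rightarrow> real^'n \<Rightarrow> ennreal"
  assumes s: "\<And>m. 0 < s m" "\<And>m. s m < 1"
    and W: "\<And>m. (\<integral>\<^sup>+z. W m z \<partial>count_space (int_vecs - {0})) < \<infinity>"
    and V: "dim V < CARD('n)"
  obtains b where "b \<notin> span V"
    "\<And>m. (\<integral>\<^sup>+z. W m z * (ennreal (infnorm z powr s m) * sing (s m) (b \<bullet> z)) \<partial>count_space (int_vecs - {0})) < \<infinity>"
proof -
  obtain v where v: "v \<noteq> 0" "\<And>y. y \<in> span V \<Longrightarrow> orthogonal v y"
    using orthogonal_to_subspace_exists[of V] V by auto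
  txt \<open>A random vector almost surely avoids the hyperplane orthogonal to \<open>v\<close>, which contains \<open>V\<close>.\<close>
  have "AE f in cube. (\<integral>\<^sup>+z. 1 * sing (1/2) (vec_lambda f \<bullet> v + 0) \<partial>count_space {v}) < \<infinity>"
    using v(1) by (intro AE_cube_sum_sing) (auto simp: nn_integral_count_space_finite sing_nonzero infnorm_eq_0)
  then have 1: "AE f in cube. vec_lambda f \<notin> span V"
  proof eventually_elim
    case (elim f)
    \<comment> \<open>The sum has a single term, which would be infinite if the inner product were
      0.\<close>
    then have "vec_lambda f \<bullet> v \<noteq> 0" by (auto simp: nn_integral_count_space_finite)
    then show ?case using v(2) by (metis orthogonal_def inner_commute)
  qed
  have 2: "AE f in cube. \<forall>m. (\<integral>\<^sup>+z. (W m z * ennreal (infnorm z powr s m)) * sing (s m) (vec_lambda f \<bullet> z + 0) \<partial>count_space (int_vecs - {0})) < \<infinity>"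
    unfolding AE_all_countable
  proof (intro allI AE_cube_sum_sing s)
    fix m
    have "(\<integral>\<^sup>+z. W m z * ennreal (infnorm z powr s m) * sing (s m) (infnorm z) \<partial>count_space (int_vecs - {0}))
      = (\<integral>\<^sup>+z. W m z \<partial>count_space (int_vecs - {0}))"
    proof (intro nn_integral_cong)
      fix z :: "real^'n" assume "z \<in> space (count_space (int_vecs - {0}))"
      then have "infnorm z > 0" by (auto simp: infnorm_pos_lt)
      then have "ennreal (infnorm z powr s m) * sing (s m) (infnorm z) = 1"
        by (simp add: sing_nonzero ennreal_mult[symmetric] powr_add[symmetric])
      then show "W m z * ennreal (infnorm z powr s m) * sing (s m) (infnorm z) = W m z"
        by (simp add: mult.assoc)
    qed
    then show "(\<integral>\<^sup>+z. W m z * ennreal (infnorm z powr s m) * sing (s m) (infnorm z) \<partial>count_space (int_vecs - {0})) < \<infinity>"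
      using W by simp
  qed (rule countable_subset[OF _ countable_int_vecs], auto)
  from 1 2 have "AE f in cube. vec_lambda f \<notin> span V \<and> (\<forall>m. (\<integral>\<^sup>+z. (W m z * ennreal (infnorm z powr s m)) * sing (s m) (vec_lambda f \<bullet> z + 0) \<partial>count_space (int_vecs - {0})) < \<infinity>)"
    by eventually_elim blast
  then obtain f :: "'n \<Rightarrow> real" where f: "vec_lambda f \<notin> span V"
    "\<forall>m. (\<integral>\<^sup>+z. (W m z * ennreal (infnorm z powr s m)) * sing (s m) (vec_lambda f \<bullet> z + 0) \<partial>count_space (int_vecs - {0})) < \<infinity>"
    by (rule AE_cube_obtain) blast
  show thesis
    by (rule that[OF f(1)]) (use f(2) in \<open>simp only: mult.assoc add_0_right\<close>)
qed

text \<open>Rows are added one at a time, the factors of earlier rows being absorbed into the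
  weight. Injectivity is carried along because independence of the image set would still permit
  repeated rows.\<close>

lemma exists_rows:
  fixes b :: "real^'n" and i0 :: 'n and W :: "nat \<Rightarrow> real^'n \<Rightarrow> ennreal"
  assumes s: "\<And>m. 0 < s m" "\<And>m. s m < 1"
    and W: "\<And>m. (\<integral>\<^sup>+z. W m z \<partial>count_space (int_vecs - {0})) < \<infinity>" and b: "b \<noteq> 0"
    and "finite I" "i0 \<notin> I"
  shows "\<exists>R. R i0 = b \<and> inj_on R (insert i0 I) \<and> independent (R ` insert i0 I) \<and>
    (\<forall>m. (\<integral>\<^sup>+z. W m z * (\<Prod>i\<in>I. ennreal (infnorm z powr s m) * sing (s m) (R i \<bullet> z)) \<partial>count_space (int_vecs - {0})) < \<infinity>)"
  using assms(5,6)
proof (induction I rule: finite_induct)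
  case empty
  show ?case using b W by (intro exI[of _ "\<lambda>_. b"]) auto
next
  case (insert i I)
  then obtain R where R: "R i0 = b" "inj_on R (insert i0 I)" "independent (R ` insert i0 I)"
    "\<And>m. (\<integral>\<^sup>+z. W m z * (\<Prod>i\<in>I. ennreal (infnorm z powr s m) * sing (s m) (R i \<bullet> z)) \<partial>count_space (int_vecs - {0})) < \<infinity>"
    by auto
  have i: "i \<notin> insert i0 I" using insert by auto
  define V where "V = R ` insert i0 I"
  \<comment> \<open>The index \<open>i\<close> is still free, so fewer than \<open>CARD('n)\<close>
    rows have been chosen.\<close>
  have "dim V \<le> card V" using insert.hyps(1) by (intro dim_le_card') (auto simp: V_def)
  also have "card V = card (insert i0 I)" unfolding V_def using R(2) by (rule card_image)
  also have "\<dots> < CARD('n)" using i by (intro psubset_card_mono finite) auto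
  finally have dimV: "dim V < CARD('n)" .
  obtain r where r: "r \<notin> span V"
    "\<And>m. (\<integral>\<^sup>+z. (W m z * (\<Prod>i\<in>I. ennreal (infnorm z powr s m) * sing (s m) (R i \<bullet> z))) *
         (ennreal (infnorm z powr s m) * sing (s m) (r \<bullet> z)) \<partial>count_space (int_vecs - {0})) < \<infinity>"
    by (rule exists_next_row[where s = s and V = V and W = "\<lambda>m z. W m z *
         (\<Prod>i\<in>I. ennreal (infnorm z powr s m) * sing (s m) (R i \<bullet> z))", OF s R(4) dimV]) blast
  define R' where "R' = R(i := r)"
  have R': "R' j = R j" if "j \<in> insert i0 I" for j using that i by (auto simp: R'_def)
  have im: "R' ` insert i0 I = V" unfolding V_def using R' by (intro image_cong) auto
  have ri: "R' i = r" by (simp add: R'_def)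
  have "r \<notin> V" using r(1) span_base by blast
  show ?case
  proof (intro exI[of _ R'] conjI allI)
    show "R' i0 = b" using R' R(1) by simp
    have "inj_on R' (insert i0 I)" using R(2) R' by (simp cong: inj_on_cong)
    then have "inj_on R' (insert i (insert i0 I))"
      using \<open>r \<notin> V\<close> i im ri by (subst inj_on_insert) auto
    then show "inj_on R' (insert i0 (insert i I))" by (simp only: insert_commute)
    have "independent (insert r V)" using r(1) R(3) by (simp add: independent_insert V_def)
    also have "insert r V = R' ` insert i0 (insert i I)" using im ri by auto
    finally show "independent (R' ` insert i0 (insert i I))" .
    fix m
    have "(\<Prod>j\<in>insert i I. ennreal (infnorm z powr s m) * sing (s m) (R' j \<bullet> z))
       = (\<Prod>i\<in>I. ennreal (infnorm z powr s m) * sing (s m) (R i \<bullet> z)) * (ennreal (infnorm z powr s m) * sing (s m) (r \<bullet> z))" for z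
    proof -
      have "(\<Prod>j\<in>I. ennreal (infnorm z powr s m) * sing (s m) (R' j \<bullet> z)) = (\<Prod>j\<in>I. ennreal (infnorm z powr s m) * sing (s m) (R j \<bullet> z))"
        using R' by (intro prod.cong) auto
      then show ?thesis using insert.hyps by (simp add: ri mult.commute)
    qed
    then show "(\<integral>\<^sup>+z. W m z * (\<Prod>j\<in>insert i I. ennreal (infnorm z powr s m) * sing (s m) (R' j \<bullet> z)) \<partial>count_space (int_vecs - {0})) < \<infinity>"
      using r(2)[of m] by (simp only: mult.assoc)
  qed
qed

section \<open>Exponents of lattices\<close>

lemma sing_prod: "sing s (prod f I) = (\<Prod>i\<in>I. sing s (f i))"
proof (induction I rule: infinite_finite_induct)
  case (insert i I)
  then show ?case by (simp add: sing_mult)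
qed (simp_all add: sing_def)

text \<open>The rows are chosen for all \<open>m\<close> at once, hence before \<epsilon>; given
  \<epsilon>, a suitable \<open>m\<close> turns convergence of the series into the lower bound. The
  row \<open>R i0\<close> alone supplies the good approximations.\<close>

lemma exists_forms:
  fixes \<gamma> :: real
  assumes n3: "CARD('n::finite) \<ge> 3" and \<gamma>: "\<gamma> \<ge> 0"
  obtains R :: "'n \<Rightarrow> real^'n" and i0 where "inj R" "independent (range R)"
    "\<And>\<epsilon>. \<epsilon> > 0 \<Longrightarrow> \<exists>c>0. \<forall>z\<in>int_vecs - {0}. c * infnorm z powr - (CARD('n) * \<gamma> + \<epsilon>) \<le> (\<Prod>i\<in>UNIV. \<bar>R i \<bullet> z\<bar>)"
    "\<And>N::nat. \<exists>z\<in>int_vecs. infnorm z > N \<and> \<bar>R i0 \<bullet> z\<bar> \<le> 4 * infnorm z powr - (real CARD('n) - 1 + CARD('n) * \<gamma>)"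
proof -
  define n where "n = real CARD('n)"
  define \<tau> where "\<tau> = n - 1 + n * \<gamma>"
  have \<tau>: "\<tau> \<ge> n - 1" "n \<ge> 3" "\<tau> \<ge> 2"
  proof -
    show "n \<ge> 3" using n3 by (simp add: n_def)
    have "n * \<gamma> \<ge> 0" using \<gamma> by (simp add: n_def)
    then show "\<tau> \<ge> n - 1" by (simp add: \<tau>_def)
    then show "\<tau> \<ge> 2" using \<open>n \<ge> 3\<close> by simp
  qed
  define A where "A m = \<tau> + 1 / (real m + 2)" for m
  define s where "s m = 1 - 1 / ((real m + 2) * (\<tau> + 3))" for m
  have s: "0 < s m" "s m < 1" for m
  proof -
    have "1 < (real m + 2) * (\<tau> + 3)" using \<tau> by (intro less_1_mult) auto
    then show "0 < s m" "s m < 1" by (auto simp: s_def)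
  qed
  obtain b :: "real^'n" where b: "b \<noteq> 0"
    "\<And>m. (\<integral>\<^sup>+z. ennreal (infnorm z powr - A m) * sing (s m) (b \<bullet> z) \<partial>count_space (int_vecs - {0})) < \<infinity>"
    "\<And>N::nat. \<exists>z\<in>int_vecs. infnorm z > N \<and> \<bar>b \<bullet> z\<bar> \<le> 4 * infnorm z powr - \<tau>"
    using exists_first_row[OF n3, of \<tau>] \<tau> unfolding A_def s_def n_def by blast
  \<comment> \<open>Any index may carry the special row \<open>b\<close>; it is unrelated to the two
    coordinates singled out in the construction of \<open>b\<close>.\<close>
  define i0 :: 'n where "i0 = undefined"
  define I where "I = UNIV - {i0}"
  have I: "finite I" "i0 \<notin> I" "insert i0 I = UNIV" "real (card I) = n - 1"
    by (auto simp: I_def n_def card_Diff_singleton of_nat_diff)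
  obtain R where R: "R i0 = b" "inj R" "independent (range R)"
    "\<And>m. (\<integral>\<^sup>+z. ennreal (infnorm z powr - A m) * sing (s m) (b \<bullet> z) *
        (\<Prod>i\<in>I. ennreal (infnorm z powr s m) * sing (s m) (R i \<bullet> z)) \<partial>count_space (int_vecs - {0})) < \<infinity>"
    using exists_rows[where s = s and W = "\<lambda>m z. ennreal (infnorm z powr - A m) * sing (s m) (b \<bullet> z)",
        OF s b(2,1) I(1,2)] unfolding I(3) by blast
  have lower: "\<exists>c>0. \<forall>z\<in>int_vecs - {0}. c * infnorm z powr - (n * \<gamma> + \<epsilon>) \<le> (\<Prod>i\<in>UNIV. \<bar>R i \<bullet> z\<bar>)"
    if "\<epsilon> > 0" for \<epsilon>
  proof -
    \<comment> \<open>\<open>A m\<close> tends to \<tau> and \<open>s m\<close> to 1, so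
      \<open>A m / s m\<close>, the exponent extracted from a single term, falls below \<tau> +
      \<epsilon>.\<close>
    have lim0: "(\<lambda>m. 1 / (real m + 2)) \<longlonglongrightarrow> 0"
      using LIMSEQ_ignore_initial_segment[OF lim_1_over_n, of 2] by (simp add: add.commute)
    have "(\<lambda>m. A m / (1 - 1 / (real m + 2) * (1 / (\<tau> + 3)))) \<longlonglongrightarrow> (\<tau> + 0) / (1 - 0 * (1 / (\<tau> + 3)))"
      unfolding A_def by (intro tendsto_intros lim0) auto
    then have "(\<lambda>m. A m / s m) \<longlonglongrightarrow> \<tau>" by (simp add: s_def)
    then have "\<forall>\<^sub>F m in sequentially. A m / s m < \<tau> + \<epsilon>"
      using that by (intro order_tendstoD) auto
    then obtain m where m: "A m / s m < \<tau> + \<epsilon>" by (auto simp: eventually_sequentially)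
    define K where "K = 1 + enn2real (\<integral>\<^sup>+z. ennreal (infnorm z powr - A m) * sing (s m) (b \<bullet> z) *
        (\<Prod>i\<in>I. ennreal (infnorm z powr s m) * sing (s m) (R i \<bullet> z)) \<partial>count_space (int_vecs - {0}))"
      (is "_ = 1 + enn2real ?J")
    have K: "K > 0" "?J \<le> ennreal K"
    proof -
      show "K > 0" unfolding K_def by (simp add: add_pos_nonneg)
      have "?J = ennreal (enn2real ?J)" using R(4)[of m] by simp
      also have "\<dots> \<le> ennreal K" by (intro ennreal_leI) (simp add: K_def)
      finally show "?J \<le> ennreal K" .
    qed
    show ?thesis
    proof (intro exI[of _ "(1 / K) powr (1 / s m)"] conjI ballI)
      show "(1 / K) powr (1 / s m) > 0" using K by simp
      fix z :: "real^'n" assume z: "z \<in> int_vecs - {0}"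
      define N where "N = infnorm z"
      have N: "N \<ge> 1" using z int_vecs_infnorm_ge_1 by (auto simp: N_def)
      define X where "X = (\<Prod>i\<in>UNIV. R i \<bullet> z)"
      define u where "u = N powr (- A m + s m * (n - 1))"
      have "u > 0" using N by (simp add: u_def)
      have "(\<Prod>i\<in>I. ennreal (N powr s m) * sing (s m) (R i \<bullet> z))
         = ennreal (N powr s m) ^ card I * (\<Prod>i\<in>I. sing (s m) (R i \<bullet> z))"
        by (simp add: prod.distrib)
      also have "ennreal (N powr s m) ^ card I = ennreal (N powr (s m * (n - 1)))"
        using N I(4) by (simp add: ennreal_power powr_power mult.commute)
      finally have "ennreal (N powr - A m) * sing (s m) (b \<bullet> z) *
          (\<Prod>i\<in>I. ennreal (N powr s m) * sing (s m) (R i \<bullet> z))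
        = (ennreal (N powr - A m) * ennreal (N powr (s m * (n - 1)))) * (sing (s m) (R i0 \<bullet> z) * (\<Prod>i\<in>I. sing (s m) (R i \<bullet> z)))"
        by (simp add: R(1) mult_ac)
      also have "sing (s m) (R i0 \<bullet> z) * (\<Prod>i\<in>I. sing (s m) (R i \<bullet> z)) = sing (s m) X"
        unfolding X_def sing_prod using I by (subst I(3)[symmetric], subst prod.insert) auto
      also have "ennreal (N powr - A m) * ennreal (N powr (s m * (n - 1))) = ennreal u"
        unfolding u_def powr_add by (rule ennreal_mult[symmetric]) auto
      \<comment> \<open>A single term is at most the whole sum.\<close>
      finally have "ennreal u * sing (s m) X \<le> ?J"
        using nn_integral_ge_point[OF z, of "\<lambda>z. ennreal (infnorm z powr - A m) * sing (s m) (b \<bullet> z) *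
          (\<Prod>i\<in>I. ennreal (infnorm z powr s m) * sing (s m) (R i \<bullet> z))"] by (simp only: N_def[symmetric])
      also note K(2)
      finally have le: "ennreal u * sing (s m) X \<le> ennreal K" .
      \<comment> \<open>As \<open>sing\<close> is infinite at 0, the bound also shows that no form
        vanishes at a nonzero integer vector.\<close>
      have X0: "X \<noteq> 0"
      proof
        assume "X = 0"
        then show False using le \<open>u > 0\<close> by (simp add: ennreal_mult_top top_unique)
      qed
      then have "ennreal (u * \<bar>X\<bar> powr - s m) \<le> ennreal K"
        using le \<open>u > 0\<close> by (simp add: sing_nonzero ennreal_mult)
      then have "u * \<bar>X\<bar> powr - s m \<le> K" using K(1) by simp
      then have "1 / K * u \<le> \<bar>X\<bar> powr s m"
        using K(1) X0 by (simp add: powr_minus field_simps)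
      then have "(1 / K * u) powr (1 / s m) \<le> (\<bar>X\<bar> powr s m) powr (1 / s m)"
        using K \<open>u > 0\<close> s[of m] by (intro powr_mono2) auto
      also have "\<dots> = \<bar>X\<bar>" using s[of m] by (simp add: powr_powr)
      also have "(1 / K * u) powr (1 / s m) = (1 / K) powr (1 / s m) * u powr (1 / s m)"
        by (rule powr_mult)
      also have "u powr (1 / s m) = N powr (- (A m / s m) + (n - 1))"
        unfolding u_def powr_powr using s[of m] by (intro arg_cong[where f="(powr) N"]) (simp add: field_simps)
      finally have "(1 / K) powr (1 / s m) * N powr (- (A m / s m) + (n - 1)) \<le> \<bar>X\<bar>" .
      moreover have "N powr - (n * \<gamma> + \<epsilon>) \<le> N powr (- (A m / s m) + (n - 1))"
        using N m by (intro powr_mono) (auto simp: \<tau>_def)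
      then have "(1 / K) powr (1 / s m) * N powr - (n * \<gamma> + \<epsilon>) \<le> (1 / K) powr (1 / s m) * N powr (- (A m / s m) + (n - 1))"
        by (intro mult_left_mono) auto
      ultimately show "(1 / K) powr (1 / s m) * infnorm z powr - (n * \<gamma> + \<epsilon>) \<le> (\<Prod>i\<in>UNIV. \<bar>R i \<bullet> z\<bar>)"
        by (simp add: N_def X_def abs_prod)
    qed
  qed
  show thesis
    by (rule that[OF R(2,3), of i0]) (use lower b(3) in \<open>auto simp: n_def \<tau>_def R(1)\<close>)
qed

section \<open>Lattices as linear images of the integer vectors\<close>

lemma int_vecs_iff: "x \<in> int_vecs \<longleftrightarrow> (\<forall>e\<in>Basis. x \<bullet> e \<in> \<int>)"
  by (auto simp: int_vecs_def Basis_vec_def cart_eq_inner_axis)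

lemma full_lattice_int_vecs_image:
  fixes T :: "real^'n \<Rightarrow> real^'n"
  assumes "linear T" "inj T"
  shows "full_lattice (T ` int_vecs)"
  unfolding full_lattice_def
proof (intro exI[of _ "T ` Basis"] conjI)
  show "independent (T ` Basis)"
    using assms by (intro linear_independent_injective_image independent_Basis) (auto intro: inj_on_subset)
  show "span (T ` Basis) = UNIV"
    using assms linear_injective_imp_surjective[OF assms] by (simp add: linear_span_image)
  have inj: "inj_on T Basis" using assms(2) by (auto intro: inj_on_subset)
  have sum: "(\<Sum>b\<in>T ` Basis. of_int (c b) *\<^sub>R b) = T (\<Sum>e\<in>Basis. of_int (c (T e)) *\<^sub>R e)" for c :: "real^'n \<Rightarrow> int"
    using assms(1) by (simp add: sum.reindex[OF inj] linear_sum linear_cmul)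
  show "T ` int_vecs = {\<Sum>b\<in>T ` Basis. of_int (c b) *\<^sub>R b | c :: real^'n \<Rightarrow> int. True}"
  proof (intro equalityI subsetI)
    fix x assume "x \<in> T ` int_vecs"
    then obtain z where z: "z \<in> int_vecs" "x = T z" by auto
    \<comment> \<open>Coefficients are indexed by the vectors of the lattice basis, so
      \<open>inv T\<close> recovers the standard basis vector. The coordinate there is already an
      integer; the floor only changes its type.\<close>
    define c where "c b = \<lfloor>z \<bullet> inv T b\<rfloor>" for b
    have "of_int (c (T e)) = z \<bullet> e" if "e \<in> Basis" for e
      using z(1) that assms(2) by (auto simp: c_def int_vecs_iff)
    then have "(\<Sum>e\<in>Basis. of_int (c (T e)) *\<^sub>R e) = (\<Sum>e\<in>Basis. (z \<bullet> e) *\<^sub>R e)"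
      by (intro sum.cong) auto
    then have "x = (\<Sum>b\<in>T ` Basis. of_int (c b) *\<^sub>R b)"
      unfolding sum z(2) by (simp add: euclidean_representation)
    then show "x \<in> {\<Sum>b\<in>T ` Basis. of_int (c b) *\<^sub>R b | c :: real^'n \<Rightarrow> int. True}" by blast
  next
    fix x assume "x \<in> {\<Sum>b\<in>T ` Basis. of_int (c b) *\<^sub>R b | c :: real^'n \<Rightarrow> int. True}"
    then obtain c :: "real^'n \<Rightarrow> int" where "x = T (\<Sum>e\<in>Basis. of_int (c (T e)) *\<^sub>R e)"
      unfolding sum by blast
    moreover have "(\<Sum>e\<in>Basis. of_int (c (T e)) *\<^sub>R e) \<in> int_vecs"
      by (simp add: int_vecs_iff)
    ultimately show "x \<in> T ` int_vecs" by blast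
  qed
qed

lemma geo_prod_eq: "geo_prod (x :: real^'n) = (\<Prod>i\<in>UNIV. \<bar>x $ i\<bar>) powr (1 / CARD('n))"
  unfolding geo_prod_def by (rule prod_powr_distrib[symmetric])

lemma full_lattice_nonzero:
  assumes "full_lattice (\<Lambda> :: (real^'n) set)"
  obtains x where "x \<in> \<Lambda>" "0 < infnorm x"
proof -
  obtain B where B: "independent B" "span B = UNIV"
    and L: "\<Lambda> = {\<Sum>b\<in>B. of_int (c b) *\<^sub>R b | c :: real^'n \<Rightarrow> int. True}"
    using assms unfolding full_lattice_def by blast
  have finB: "finite B" using B(1) by (rule independent_imp_finite)
  have "B \<noteq> {}"
  proof
    assume "B = {}"
    then have "(1 :: real^'n) = 0" using B(2) by (metis UNIV_I span_empty singletonD)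
    then show False by simp
  qed
  then obtain b where b: "b \<in> B" by auto
  have "(\<Sum>a\<in>B. of_int (if a = b then 1 else 0) *\<^sub>R a) = (\<Sum>a\<in>B. if a = b then b else 0)"
    by (intro sum.cong) auto
  also have "\<dots> = b" using finB b by simp
  finally have "b \<in> \<Lambda>" unfolding L by (intro CollectI exI[of _ "\<lambda>a. if a = b then 1 else 0"]) auto
  moreover have "b \<noteq> 0" using b B(1) dependent_zero by blast
  ultimately show thesis using that by (auto simp: infnorm_pos_lt)
qed

section \<open>Criteria for the value of the exponent\<close>

lemma lattice_psi_le:
  assumes "full_lattice \<Lambda>" "x \<in> \<Lambda>" "0 < infnorm x" "infnorm x \<le> t"
  shows "lattice_psi \<Lambda> t \<le> geo_prod x"
  unfolding lattice_psi_def using assms finite_lattice_points[OF assms(1)] by (intro Min_le) auto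

lemma lattice_psi_attained:
  assumes "full_lattice \<Lambda>" "x \<in> \<Lambda>" "0 < infnorm x" "infnorm x \<le> t"
  obtains y where "y \<in> \<Lambda>" "0 < infnorm y" "infnorm y \<le> t" "lattice_psi \<Lambda> t = geo_prod y"
proof -
  have "lattice_psi \<Lambda> t \<in> geo_prod ` {x \<in> \<Lambda>. 0 < infnorm x \<and> infnorm x \<le> t}"
    unfolding lattice_psi_def using assms finite_lattice_points[OF assms(1)] by (intro Min_in) auto
  then show thesis using that by auto
qed

text \<open>Otherwise \<open>f\<close> would eventually exceed \<open>C\<close>; control at
  arbitrarily large \<open>t\<close> is therefore enough.\<close>

lemma Liminf_finiteI:
  assumes "\<And>N::nat. \<exists>t\<ge>real N. f t \<le> C"
  shows "Liminf at_top (\<lambda>t. ereal (f t)) < \<infinity>"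
proof (rule ccontr)
  assume "\<not> ?thesis"
  then have "ereal C < Liminf at_top (\<lambda>t. ereal (f t))" by simp
  then have "\<forall>\<^sub>F t in at_top. ereal C < ereal (f t)" by (rule less_LiminfD)
  then obtain t0 where t0: "\<And>t. t \<ge> t0 \<Longrightarrow> C < f t" by (auto simp: eventually_at_top_linorder)
  obtain N :: nat where "t0 \<le> real N" using real_arch_simple by blast
  then show False using assms[of N] t0 by (meson order_trans not_less)
qed

text \<open>For large \<open>t\<close> the minimum is at most the product of one fixed nonzero
  lattice point, so the exponent 0 is admissible.\<close>

lemma dioph_exponent_nonneg:
  assumes "full_lattice \<Lambda>"
  shows "0 \<le> dioph_exponent \<Lambda>"
proof -
  obtain x where x: "x \<in> \<Lambda>" "0 < infnorm x" using full_lattice_nonzero[OF assms] .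
  have "Liminf at_top (\<lambda>t::real. ereal (t powr 0 * lattice_psi \<Lambda> t)) < \<infinity>"
  proof (rule Liminf_finiteI)
    fix N :: nat
    define t where "t = max (real N) (infnorm x)"
    have "lattice_psi \<Lambda> t \<le> geo_prod x"
      using assms x by (intro lattice_psi_le) (auto simp: t_def)
    then show "\<exists>t\<ge>real N. t powr 0 * lattice_psi \<Lambda> t \<le> geo_prod x"
      using x by (intro exI[of _ t]) (auto simp: t_def)
  qed
  then have "ereal 0 \<le> dioph_exponent \<Lambda>"
    unfolding dioph_exponent_def by (intro Sup_upper) blast
  then show ?thesis by (simp add: zero_ereal_def)
qed

text \<open>The points from \<open>approx\<close>, with \<open>t\<close> equal to their norms, show
  that \<gamma> itself is admissible. For any larger exponent \<gamma>', \<open>lower\<close> forces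
  \<open>t powr \<gamma>' * lattice_psi \<Lambda> t\<close> to tend to infinity.\<close>

lemma dioph_exponent_eqI:
  fixes \<Lambda> :: "(real^'n) set"
  assumes L: "full_lattice \<Lambda>" and \<gamma>: "\<gamma> \<ge> 0"
    and lower: "\<And>\<gamma>'. \<gamma>' > \<gamma> \<Longrightarrow> \<exists>c>0. \<forall>x\<in>\<Lambda>. 0 < infnorm x \<longrightarrow> c * infnorm x powr - \<gamma>' \<le> geo_prod x"
    and approx: "\<And>N::nat. \<exists>x\<in>\<Lambda>. infnorm x > N \<and> geo_prod x \<le> C * infnorm x powr - \<gamma>"
  shows "dioph_exponent \<Lambda> = ereal \<gamma>"
proof (rule antisym)
  have "Liminf at_top (\<lambda>t::real. ereal (t powr \<gamma> * lattice_psi \<Lambda> t)) < \<infinity>"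
  proof (rule Liminf_finiteI)
    fix N :: nat
    obtain x where x: "x \<in> \<Lambda>" "infnorm x > N" "geo_prod x \<le> C * infnorm x powr - \<gamma>" using approx by blast
    have x0: "infnorm x > 0" using x(2) by linarith
    have "lattice_psi \<Lambda> (infnorm x) \<le> geo_prod x" using L x x0 by (intro lattice_psi_le) auto
    with x(3) have "infnorm x powr \<gamma> * lattice_psi \<Lambda> (infnorm x) \<le> infnorm x powr \<gamma> * (C * infnorm x powr - \<gamma>)"
      by (intro mult_left_mono) auto
    also have "\<dots> = C" using x0 by (simp add: powr_minus field_simps)
    finally show "\<exists>t\<ge>real N. t powr \<gamma> * lattice_psi \<Lambda> t \<le> C"
      using x(2) by (intro exI[of _ "infnorm x"]) auto
  qed
  then show "ereal \<gamma> \<le> dioph_exponent \<Lambda>"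
    unfolding dioph_exponent_def by (intro Sup_upper) blast
  show "dioph_exponent \<Lambda> \<le> ereal \<gamma>"
    unfolding dioph_exponent_def
  proof (rule Sup_least, clarify)
    fix \<gamma>' assume fin: "Liminf at_top (\<lambda>t::real. ereal (t powr \<gamma>' * lattice_psi \<Lambda> t)) < \<infinity>"
    have "\<not> \<gamma> < \<gamma>'"
    proof
      assume less: "\<gamma> < \<gamma>'"
      \<comment> \<open>Using \<open>lower\<close> at \<gamma>' would only bound the function away
        from 0; at the smaller exponent \<beta> the growing factor
        \<open>t powr (\<gamma>' - \<beta>)\<close> is gained.\<close>
      define \<beta> where "\<beta> = (\<gamma> + \<gamma>') / 2"
      have \<beta>: "\<gamma> < \<beta>" "\<beta> < \<gamma>'" using less by (auto simp: \<beta>_def)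
      obtain c where c: "c > 0" "\<And>x. x \<in> \<Lambda> \<Longrightarrow> 0 < infnorm x \<Longrightarrow> c * infnorm x powr - \<beta> \<le> geo_prod x"
        using lower[OF \<beta>(1)] by blast
      \<comment> \<open>From \<open>t = infnorm x\<close> on, the minimum is over a nonempty set and
        is attained.\<close>
      obtain x where x: "x \<in> \<Lambda>" "0 < infnorm x" using full_lattice_nonzero[OF L] .
      have "\<forall>\<^sub>F t in at_top. c * t powr (\<gamma>' - \<beta>) \<le> t powr \<gamma>' * lattice_psi \<Lambda> t"
        using eventually_ge_at_top[of "infnorm x"]
      proof eventually_elim
        case (elim t)
        obtain y where y: "y \<in> \<Lambda>" "0 < infnorm y" "infnorm y \<le> t" "lattice_psi \<Lambda> t = geo_prod y"
          using lattice_psi_attained[OF L x elim] .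
        have "t powr - \<beta> \<le> infnorm y powr - \<beta>" using y \<beta> \<gamma> by (intro powr_mono2') auto
        then have "c * t powr - \<beta> \<le> c * infnorm y powr - \<beta>" using c(1) by (intro mult_left_mono) auto
        also have "\<dots> \<le> lattice_psi \<Lambda> t" using c(2)[OF y(1,2)] y(4) by simp
        finally have "t powr \<gamma>' * (c * t powr - \<beta>) \<le> t powr \<gamma>' * lattice_psi \<Lambda> t"
          by (intro mult_left_mono) auto
        then show ?case by (simp add: powr_diff powr_minus field_simps)
      qed
      moreover have "filterlim (\<lambda>t. c * t powr (\<gamma>' - \<beta>)) at_top at_top"
        using c(1) \<beta> by (intro filterlim_tendsto_pos_mult_at_top[OF tendsto_const] real_powr_at_top) auto
      ultimately have "filterlim (\<lambda>t. t powr \<gamma>' * lattice_psi \<Lambda> t) at_top at_top"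
        by (rule filterlim_at_top_mono[rotated])
      then have "((\<lambda>t. ereal (t powr \<gamma>' * lattice_psi \<Lambda> t)) \<longlongrightarrow> \<infinity>) at_top"
        by (simp add: tendsto_PInfty_eq_at_top)
      then have "Liminf at_top (\<lambda>t. ereal (t powr \<gamma>' * lattice_psi \<Lambda> t)) = \<infinity>"
        by (intro lim_imp_Liminf) auto
      then show False using fin by simp
    qed
    then show "ereal \<gamma>' \<le> ereal \<gamma>" by simp
  qed
qed

text \<open>The lattice is the image of the integer vectors under the map with rows
  \<open>R i\<close>. This map changes the maximum norm by bounded factors only, so the estimates of
  \<open>exists_forms\<close> pass from \<open>z\<close> to \<open>T z\<close> with other constants,
  and the root in \<open>geo_prod\<close> turns \<open>n * \<gamma>\<close> into \<gamma>.\<close>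

lemma exists_lattice_exponent:
  fixes \<gamma> :: real
  assumes n3: "CARD('n::finite) \<ge> 3" and \<gamma>: "\<gamma> \<ge> 0"
  shows "\<exists>\<Lambda> :: (real^'n) set. full_lattice \<Lambda> \<and> dioph_exponent \<Lambda> = ereal \<gamma>"
proof -
  define n where "n = real CARD('n)"
  have n: "n \<ge> 3" using n3 by (simp add: n_def)
  obtain R :: "'n \<Rightarrow> real^'n" and i0 where R: "inj R" "independent (range R)"
    and lower: "\<And>\<epsilon>. \<epsilon> > 0 \<Longrightarrow> \<exists>c>0. \<forall>z\<in>int_vecs - {0}. c * infnorm z powr - (n * \<gamma> + \<epsilon>) \<le> (\<Prod>i\<in>UNIV. \<bar>R i \<bullet> z\<bar>)"
    and approx: "\<And>N::nat. \<exists>z\<in>int_vecs. infnorm z > N \<and> \<bar>R i0 \<bullet> z\<bar> \<le> 4 * infnorm z powr - (n - 1 + n * \<gamma>)"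
    by (rule exists_forms[OF n3 \<gamma>, folded n_def]) (rule that)
  define T where "T z = (\<chi> i. R i \<bullet> z)" for z
  have lin: "linear T"
    by (intro linearI) (auto simp: T_def vec_eq_iff inner_add_right)
  have span: "span (range R) = UNIV"
  proof -
    have "card (range R) = CARD('n)" using R(1) by (simp add: card_image)
    then have "UNIV \<subseteq> span (range R)"
      using R(2) by (intro card_ge_dim_independent) auto
    then show ?thesis by auto
  qed
  have "z = 0" if "T z = 0" for z
  proof -
    have "R i \<bullet> z = 0" for i using that by (simp add: T_def vec_eq_iff)
    then have "orthogonal z y" if "y \<in> range R" for y
      using that by (auto simp: orthogonal_def inner_commute)
    then have "orthogonal z z" using span by (intro orthogonal_to_span[of z "range R"]) auto
    then show ?thesis by (simp add: orthogonal_def)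
  qed
  then have inj: "inj T" using lin by (simp add: linear_injective_0)
  obtain k where k: "k > 0" "\<And>z. k * infnorm z \<le> infnorm (T z)"
  proof -
    obtain B where B: "B > 0" "\<And>z. B * norm z \<le> norm (T z)"
      using linear_inj_bounded_below_pos[OF lin inj] by blast
    have "B / sqrt n * infnorm z \<le> infnorm (T z)" for z
    proof -
      have "B * infnorm z \<le> B * norm z" using B(1) infnorm_le_norm by (intro mult_left_mono) auto
      also have "\<dots> \<le> norm (T z)" by (rule B)
      also have "\<dots> \<le> sqrt n * infnorm (T z)" using norm_le_infnorm[of "T z"] by (simp add: n_def)
      finally show ?thesis using n by (simp add: field_simps)
    qed
    then show thesis using that[of "B / sqrt n"] B(1) n by auto
  qed
  define S where "S = 1 + (\<Sum>i\<in>UNIV. \<Sum>j\<in>UNIV. \<bar>R i $ j\<bar>)"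
  have S0: "S > 0" unfolding S_def by (intro add_pos_nonneg sum_nonneg) auto
  have S: "\<bar>R i \<bullet> z\<bar> \<le> S * infnorm z" for i z
  proof -
    have "\<bar>R i \<bullet> z\<bar> \<le> (\<Sum>j\<in>UNIV. \<bar>R i $ j\<bar>) * infnorm z" by (rule infnorm_le_bound_inner)
    also have "(\<Sum>j\<in>UNIV. \<bar>R i $ j\<bar>) \<le> (\<Sum>i\<in>UNIV. \<Sum>j\<in>UNIV. \<bar>R i $ j\<bar>)"
      by (rule member_le_sum) (auto intro: sum_nonneg)
    also have "\<dots> \<le> S" by (simp add: S_def)
    finally show ?thesis by (simp add: infnorm_pos_le mult_right_mono)
  qed
  have TS: "infnorm (T z) \<le> S * infnorm z" for z
    unfolding infnorm_le_iff using S by (simp add: T_def)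
  have geo: "geo_prod (T z) = (\<Prod>i\<in>UNIV. \<bar>R i \<bullet> z\<bar>) powr (1 / n)" for z
    by (simp add: geo_prod_eq T_def n_def)
  have full: "full_lattice (T ` int_vecs)" by (rule full_lattice_int_vecs_image[OF lin inj])
  \<comment> \<open>The factor \<open>S powr (n - 1)\<close> comes from the forms other than
    \<open>R i0\<close>, and \<open>S powr \<gamma>\<close> from replacing \<open>infnorm z\<close>
    by \<open>infnorm (T z)\<close>.\<close>
  define C where "C = (4 * S powr (n - 1)) powr (1 / n) * S powr \<gamma>"
  have "dioph_exponent (T ` int_vecs) = ereal \<gamma>"
  proof (rule dioph_exponent_eqI[OF full \<gamma>, where C = C])
    fix \<gamma>' assume less: "\<gamma> < \<gamma>'"
    then obtain c where c: "c > 0" "\<And>z. z \<in> int_vecs - {0} \<Longrightarrow> c * infnorm z powr - (n * \<gamma>') \<le> (\<Prod>i\<in>UNIV. \<bar>R i \<bullet> z\<bar>)"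
      using lower[of "n * (\<gamma>' - \<gamma>)"] n by (auto simp: algebra_simps)
    show "\<exists>c>0. \<forall>x\<in>T ` int_vecs. 0 < infnorm x \<longrightarrow> c * infnorm x powr - \<gamma>' \<le> geo_prod x"
    proof (intro exI[of _ "c powr (1 / n) * k powr \<gamma>'"] conjI ballI impI)
      show "c powr (1 / n) * k powr \<gamma>' > 0" using c(1) k(1) by simp
      fix x assume "x \<in> T ` int_vecs" and x0: "0 < infnorm x"
      then obtain z where z: "z \<in> int_vecs" "x = T z" by blast
      have z0: "z \<noteq> 0" using x0 lin by (auto simp: z(2) infnorm_pos_lt linear_0)
      have zpos: "infnorm z > 0" using z0 by (simp add: infnorm_pos_lt)
      have "k powr \<gamma>' * infnorm x powr - \<gamma>' \<le> k powr \<gamma>' * (k * infnorm z) powr - \<gamma>'"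
        using k(2)[of z] k(1) zpos less \<gamma> by (intro mult_left_mono powr_mono2') (auto simp: z(2))
      also have "\<dots> = infnorm z powr - \<gamma>'"
        using k(1) by (simp add: powr_mult powr_minus)
      finally have "c powr (1 / n) * k powr \<gamma>' * infnorm x powr - \<gamma>' \<le> c powr (1 / n) * infnorm z powr - \<gamma>'"
        by (simp add: mult.assoc mult_left_mono)
      also have "\<dots> = (c * infnorm z powr - (n * \<gamma>')) powr (1 / n)"
        using n by (simp add: powr_mult powr_powr)
      also have "\<dots> \<le> geo_prod x"
        unfolding z(2) geo using c z z0 n by (intro powr_mono2) auto
      finally show "c powr (1 / n) * k powr \<gamma>' * infnorm x powr - \<gamma>' \<le> geo_prod x" .
    qed
  next
    fix N :: nat
    \<comment> \<open>By the lower bound with \<open>k\<close>, a point with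
      \<open>infnorm z > M\<close> has \<open>infnorm (T z) > N\<close>.\<close>
    obtain M :: nat where M: "real N / k \<le> M" using real_arch_simple by blast
    obtain z where z: "z \<in> int_vecs" "infnorm z > M" "\<bar>R i0 \<bullet> z\<bar> \<le> 4 * infnorm z powr - (n - 1 + n * \<gamma>)"
      using approx by blast
    have zpos: "infnorm z > 0" using z(2) by linarith
    have "real N \<le> k * M" using M k(1) by (simp add: field_simps)
    also have "\<dots> < k * infnorm z" using z(2) k(1) by (rule mult_strict_left_mono)
    finally have "real N < k * infnorm z" .
    then have big: "infnorm (T z) > N" using k(2)[of z] by linarith
    \<comment> \<open>The other \<open>n - 1\<close> forms are at most \<open>S * infnorm z\<close>,
      which cancels the summand \<open>n - 1\<close> in the exponent for
      \<open>R i0\<close>.\<close>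
    have "(\<Prod>i\<in>UNIV. \<bar>R i \<bullet> z\<bar>) = \<bar>R i0 \<bullet> z\<bar> * (\<Prod>i\<in>UNIV - {i0}. \<bar>R i \<bullet> z\<bar>)"
      by (simp add: prod.remove)
    also have "\<dots> \<le> (4 * infnorm z powr - (n - 1 + n * \<gamma>)) * (\<Prod>i\<in>UNIV - {i0}. S * infnorm z)"
      using z(3) S by (intro mult_mono prod_mono prod_nonneg) auto
    also have "(\<Prod>i\<in>UNIV - {i0}. S * infnorm z) = (S * infnorm z) powr (n - 1)"
      using S0 zpos n3 by (simp add: card_Diff_singleton powr_realpow[symmetric] n_def of_nat_diff)
    also have "(4 * infnorm z powr - (n - 1 + n * \<gamma>)) * (S * infnorm z) powr (n - 1)
        = 4 * S powr (n - 1) * (infnorm z powr - (n - 1 + n * \<gamma>) * infnorm z powr (n - 1))"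
      by (simp add: powr_mult)
    also have "infnorm z powr - (n - 1 + n * \<gamma>) * infnorm z powr (n - 1) = infnorm z powr - (n * \<gamma>)"
      by (subst powr_add[symmetric]) simp
    finally have "geo_prod (T z) \<le> (4 * S powr (n - 1) * infnorm z powr - (n * \<gamma>)) powr (1 / n)"
      unfolding geo using n by (intro powr_mono2) (auto intro: prod_nonneg)
    also have "\<dots> = (4 * S powr (n - 1)) powr (1 / n) * infnorm z powr - \<gamma>"
      using n by (simp add: powr_mult powr_powr)
    also have "infnorm z powr - \<gamma> = S powr \<gamma> * (S * infnorm z) powr - \<gamma>"
      using S0 by (simp add: powr_mult powr_minus)
    also have "(4 * S powr (n - 1)) powr (1 / n) * (S powr \<gamma> * (S * infnorm z) powr - \<gamma>) = C * (S * infnorm z) powr - \<gamma>"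
      by (simp add: C_def)
    also have "\<dots> \<le> C * infnorm (T z) powr - \<gamma>"
      using TS[of z] big \<gamma> by (intro mult_left_mono powr_mono2') (auto simp: C_def)
    finally show "\<exists>x\<in>T ` int_vecs. infnorm x > N \<and> geo_prod x \<le> C * infnorm x powr - \<gamma>"
      using z(1) big by blast
  qed
  with full show ?thesis by blast
qed

text \<open>A unit vector has a zero coordinate in dimension above 1, so its product is 0. Hence
  \<open>lattice_psi\<close> is at most 0 for large \<open>t\<close>, and every real \<gamma> is
  admissible.\<close>

lemma dioph_exponent_int_vecs:
  assumes n3: "CARD('n::finite) \<ge> 3"
  shows "full_lattice (int_vecs :: (real^'n) set)" "dioph_exponent (int_vecs :: (real^'n) set) = \<infinity>"
proof -
  show full: "full_lattice (int_vecs :: (real^'n) set)"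
    using full_lattice_int_vecs_image[of "\<lambda>x. x"] by (simp add: linear_ident)
  obtain i0 i1 :: 'n where i01: "i0 \<noteq> i1"
    by (rule obtain_distinct[where 'n='n]) (use n3 in linarith)
  define x :: "real^'n" where "x = axis i0 1"
  have x: "x \<in> int_vecs" "0 < infnorm x"
    by (auto simp: x_def int_vecs_def axis_def infnorm_pos_lt vec_eq_iff)
  have "geo_prod x = 0" unfolding geo_prod_def
    by (rule prod_zero) (use i01 in \<open>auto simp: x_def axis_def intro!: bexI[of _ i1]\<close>)
  have psi: "lattice_psi (int_vecs :: (real^'n) set) t \<le> 0" if "t \<ge> infnorm x" for t
    using lattice_psi_le[OF full x that] \<open>geo_prod x = 0\<close> by simp
  have "Liminf at_top (\<lambda>t::real. ereal (t powr \<gamma> * lattice_psi (int_vecs :: (real^'n) set) t)) < \<infinity>" for \<gamma>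
  proof (rule Liminf_finiteI)
    fix N :: nat
    show "\<exists>t\<ge>real N. t powr \<gamma> * lattice_psi (int_vecs :: (real^'n) set) t \<le> 0"
      using psi by (intro exI[of _ "max (real N) (infnorm x)"]) (auto simp: mult_nonneg_nonpos)
  qed
  then have "ereal \<gamma> \<le> dioph_exponent (int_vecs :: (real^'n) set)" for \<gamma>
    unfolding dioph_exponent_def by (intro Sup_upper) blast
  then show "dioph_exponent (int_vecs :: (real^'n) set) = \<infinity>" by (rule ereal_top)
qed

theorem theorem1:
  assumes "CARD('n::finite) \<ge> 3"
  shows "{dioph_exponent \<Lambda> | \<Lambda> :: (real^'n) set. full_lattice \<Lambda>} = {0..\<infinity>}"
proof (intro equalityI subsetI)
  fix w assume "w \<in> {dioph_exponent \<Lambda> | \<Lambda> :: (real^'n) set. full_lattice \<Lambda>}"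
  then show "w \<in> {0..\<infinity>}" using dioph_exponent_nonneg by auto
next
  fix w :: ereal assume "w \<in> {0..\<infinity>}"
  then consider "w = \<infinity>" | \<gamma> where "w = ereal \<gamma>" "\<gamma> \<ge> 0"
    by (cases w) auto
  then show "w \<in> {dioph_exponent \<Lambda> | \<Lambda> :: (real^'n) set. full_lattice \<Lambda>}"
  proof cases
    case 1
    then show ?thesis using dioph_exponent_int_vecs[OF assms] by (auto intro!: exI[of _ int_vecs])
  next
    case 2
    obtain \<Lambda> :: "(real^'n) set" where "full_lattice \<Lambda>" "dioph_exponent \<Lambda> = ereal \<gamma>"
      using exists_lattice_exponent[OF assms 2(2)] by blast
    then show ?thesis using 2(1) by (intro CollectI exI[of _ \<Lambda>]) simp
  qed
qed

end
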